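(* There is a constant such that, for all sufficiently large $n$ and all $k \geq 1600 \ln n$ (for which $\mathbf{NGC}_{n,k}$ is well defined), the robust randomized one-way communication complexity of $\mathbf{NGC}_{n,k}$ with error $1/3$ is $\Omega(n)$ bits.
   Context: $\mathbf{NGC}_{n,k}$ (Noisy Gap Cycle Counting) is the following problem. The input is an $n$-vertex graph $G=(V,E)$ of one of two types: (i) $G$ contains $n/(4k)$ vertex-disjoint cycles of length $2k$, or (ii) $G$ contains $n/(2k)$ vertex-disjoint cycles of length $k$. In both cases $G$ additionally contains $n/(2k)$ vertex-disjoint paths of length $k-1$. The goal is to decide which type $G$ is. Robust one-way communication model: an input graph $G$ is chosen adversarially from the allowed class. Each edge of $G$ is then independently and uniformly at random assigned either to Alice's edge set $E_A$ or to Bob's edge set $E_B$. The players share public random bits $R$. Alice sends a single message depending on $(E_A,R)$ to Bob, and Bob outputs an answer depending on the message, $E_B$ and $R$. A protocol has error $\delta$ if for every allowed $G$ it outputs the correct answer with probability at least $1-\delta$, where the probability is over the random edge partition and over $R$. Its cost is the worst-case length of Alice's message. The robust randomized one-way communication complexity with error $\delta$ is the minimum cost of a protocol with error $\delta$. *)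

theory Defs
  imports "HOL-Probability.Probability" "HOL-Library.Extended_Nat"
begin

text \<open>Undirected graphs on the vertex set \<open>{..<n}\<close> are given by their edge sets; an edge is the
  set of its two endpoints.\<close>

type_synonym edge = "nat set"

definition cycle_edges :: "nat list \<Rightarrow> edge set" where
  "cycle_edges vs = {{vs ! i, vs ! (Suc i mod length vs)} | i. i < length vs}"

definition path_edges :: "nat list \<Rightarrow> edge set" where
  "path_edges vs = {{vs ! i, vs ! Suc i} | i. Suc i < length vs}"

text \<open>\<open>E\<close> consists of \<open>a\<close> cycles of length \<open>l\<close> and \<open>b\<close> paths of length \<open>m\<close> (lengths count edges,
  so a path of length \<open>m\<close> has \<open>m + 1\<close> vertices), all of them vertex-disjoint, and no other edges.\<close>

definition disjoint_cycles_paths ::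
    "nat \<Rightarrow> nat \<Rightarrow> nat \<Rightarrow> nat \<Rightarrow> nat \<Rightarrow> edge set \<Rightarrow> bool" where
  "disjoint_cycles_paths n a l b m E \<longleftrightarrow>
     (\<exists>cs ps. length cs = a \<and> (\<forall>c\<in>set cs. length c = l) \<and>
              length ps = b \<and> (\<forall>p\<in>set ps. length p = m + 1) \<and>
              distinct (concat (cs @ ps)) \<and> set (concat (cs @ ps)) \<subseteq> {..<n} \<and>
              E = (\<Union>c\<in>set cs. cycle_edges c) \<union> (\<Union>p\<in>set ps. path_edges p))"

text \<open>A promise problem is the set of pairs of an allowed edge set and its correct answer. In
  \<open>NGC\<close> the answer \<open>True\<close> stands for cycles of length \<open>2k\<close>, and \<open>False\<close> for cycles of length \<open>k\<close>.
  The cycles and paths together have exactly \<open>n\<close> vertices.\<close>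

definition NGC :: "nat \<Rightarrow> nat \<Rightarrow> (edge set \<times> bool) set" where
  "NGC n k =
     {(E, True) | E. disjoint_cycles_paths n (n div (4 * k)) (2 * k) (n div (2 * k)) (k - 1) E} \<union>
     {(E, False) | E. disjoint_cycles_paths n (n div (2 * k)) k (n div (2 * k)) (k - 1) E}"

definition NGC_well_defined :: "nat \<Rightarrow> nat \<Rightarrow> bool" where
  "NGC_well_defined n k \<longleftrightarrow> n > 0 \<and> k \<ge> 3 \<and> 4 * k dvd n"

text \<open>The public randomness is an infinite sequence of independent fair bits, so a protocol may use
  as many of them as it likes.\<close>

type_synonym coins = "nat \<Rightarrow> bool"

definition coin_space :: "coins measure" where
  "coin_space = (\<Pi>\<^sub>M i\<in>UNIV. measure_pmf (bernoulli_pmf (1/2)))"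

text \<open>The edge \<open>e\<close> goes to Alice if \<open>s e\<close> holds, and to Bob otherwise.\<close>

definition edge_assignment :: "edge set \<Rightarrow> (edge \<Rightarrow> bool) pmf" where
  "edge_assignment E = Pi_pmf E False (\<lambda>_. bernoulli_pmf (1/2))"

type_synonym alice = "edge set \<Rightarrow> coins \<Rightarrow> bool list"
type_synonym bob = "bool list \<Rightarrow> edge set \<Rightarrow> coins \<Rightarrow> bool"

definition protocol :: "alice \<Rightarrow> bob \<Rightarrow> bool" where
  "protocol A B \<longleftrightarrow>
     (\<forall>E\<^sub>A. A E\<^sub>A \<in> measurable coin_space (count_space UNIV)) \<and>
     (\<forall>msg E\<^sub>B. B msg E\<^sub>B \<in> measurable coin_space (count_space UNIV))"

definition success_prob :: "alice \<Rightarrow> bob \<Rightarrow> edge set \<Rightarrow> bool \<Rightarrow> real" where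
  "success_prob A B E ans =
     measure (measure_pmf (edge_assignment E) \<Otimes>\<^sub>M coin_space)
       {(s, R). B (A {e \<in> E. s e} R) {e \<in> E. \<not> s e} R = ans}"

definition has_error :: "(edge set \<times> bool) set \<Rightarrow> real \<Rightarrow> alice \<Rightarrow> bob \<Rightarrow> bool" where
  "has_error P \<delta> A B \<longleftrightarrow> (\<forall>(E, ans)\<in>P. success_prob A B E ans \<ge> 1 - \<delta>)"

text \<open>The worst case is over all edge sets that Alice can receive and all outcomes of the coins.\<close>

definition cost :: "(edge set \<times> bool) set \<Rightarrow> alice \<Rightarrow> enat" where
  "cost P A = (SUP E\<^sub>A \<in> (\<Union>(E, ans)\<in>P. Pow E). SUP R. enat (length (A E\<^sub>A R)))"

text \<open>The infimum is a minimum, since \<^typ>\<open>enat\<close> is well-ordered.\<close>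

definition robust_cc :: "(edge set \<times> bool) set \<Rightarrow> real \<Rightarrow> enat" where
  "robust_cc P \<delta> = Inf {cost P A | A B. protocol A B \<and> has_error P \<delta> A B}"

end

theory Submission
  imports Defs
begin

text \<open>Write \<open>n = 4tk\<close>. The hard graphs are made of \<open>2t\<close> components, each a sequence of \<open>k\<close> layers of two
  vertices with a two-edge matching, straight or twisted, between consecutive layers: \<open>t\<close> of them
  are closed up (double cycles), the other \<open>t\<close> are not (double paths). A double cycle is one \<open>2k\<close>-cycle
  or two \<open>k\<close>-cycles according to whether its number of twists is odd or even. The arrangement of the
  layers and the twists are uniformly random.

  A window of three consecutive matchings is good if Alice gets the whole middle matching and Bob
  the two outer ones, which has probability \<open>1/64\<close>. Alice sees the twist of the middle matching
  of a good window but not where it sits, and Bob sees where it sits but not its twist. Hence the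
  answer is the common value of \<open>t\<close> parities of disjoint random sets of bits \<open>x\<close> of Alice, masked by twists
  \<open>r\<close> that only Bob sees. Expanding the indicator of the common value in characters, averaging over \<open>r\<close>
  and over the positions leaves the Fourier weight, on the levels \<open>h, 2h, ..., th\<close>, of the set of
  inputs \<open>x\<close> with a given message, where \<open>h\<close> is the number of good windows per component. The level
  inequality bounds this weight for messages of \<open>o(th)\<close> bits, and \<open>k \<ge> 1600 ln n\<close> makes
  \<open>h \<ge> 2 ln n\<close> with high probability in all components simultaneously.\<close>

subsection \<open>Level inequality on the cube\<close>

text \<open>The double paths are there for secrecy. If all windows lay on double cycles, then for
  odd \<open>t\<close> the parity of all of Alice's bits, wherever they sit, would determine the
  answer. With as many windows on paths, \<open>i\<close> components occupy \<open>h * i\<close> of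
  \<open>2 * t * h\<close> positions, a uniformly random one of at least
  \<open>(2 * t / i) ^ (h * i)\<close> sets. The level inequality with noise \<open>i / t\<close>
  loses only \<open>(t / i) ^ (h * i)\<close> against this, a net gain of
  \<open>2 ^ (h * i)\<close>. Messages of \<open>h * t / 64\<close> bits spend
  \<open>2 ^ (h * i / 4)\<close> of it; the rest beats the number of sets of \<open>i\<close>
  components once \<open>t * 2 powr (- 3 * h / 4)\<close> is small, so \<open>h\<close> must exceed
  a multiple of \<open>ln t\<close>. The masks \<open>r\<close> make the characters of different
  sets of components orthogonal, so that squares of Fourier coefficients suffice although Bob's
  decision is arbitrary. Most random graphs violate the promise, so graphs are weighted by the
  difference of the two conditional densities. Error 1/3 forces an advantage of 1/3, whereas short
  messages allow 1/10 on typical partitions plus 1/10 for the others.\<close>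

lemma powr_sum_le:
  fixes d q :: real
  assumes d: "0 \<le> d" "d \<le> 1" and q: "0 < q" "q \<le> 1"
  shows "(1 + d) powr q + (1 - d) powr q \<le> 2 - q * (1 - q) * d\<^sup>2 / 2"
proof -
  define g where "g = (\<lambda>d::real. 2 - q * (1 - q) * d\<^sup>2 / 2 - (1 + d) powr q - (1 - d) powr q)"
  have cont: "continuous_on {0..d} g"
    unfolding g_def using d q by (intro continuous_intros continuous_on_powr') auto
  have "g 0 \<le> g d"
  \<comment> \<open>At \<open>d = 1\<close> the term \<open>(1 - x) powr q\<close> need not be
    differentiable, hence the rule that asks only for continuity at the ends.\<close>
  proof (rule DERIV_nonneg_imp_increasing_open[OF d(1) _ cont])
    fix x assume x: "0 < x" "x < d"
    have x1: "x < 1" using x d by simp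
    have D: "(g has_real_derivative - (q * (1 - q) * x) - q * (1 + x) powr (q - 1) + q * (1 - x) powr (q - 1)) (at x)"
      unfolding g_def using x x1 by (auto intro!: derivative_eq_intros simp: field_simps)
    \<comment> \<open>In the derivative \<open>(1 + x) powr (q - 1)\<close> is at most 1, while
      \<open>(1 - x) powr (q - 1)\<close>, written as an exponential, exceeds 1 by enough to pay for
      the quadratic term.\<close>
    have "1 + (1 - q) * x \<le> 1 + (1 - q) * (- ln (1 - x))"
      using ln_add_one_self_le_self2[of "- x"] x x1 q by (intro add_left_mono mult_left_mono) auto
    also have "\<dots> \<le> exp ((1 - q) * (- ln (1 - x)))" by (rule exp_ge_add_one_self)
    also have "\<dots> = (1 - x) powr (q - 1)" using x1 by (simp add: powr_def algebra_simps)
    finally have 1: "1 + (1 - q) * x \<le> (1 - x) powr (q - 1)" .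
    have 2: "(1 + x) powr (q - 1) \<le> 1"
      using powr_mono[of "q - 1" 0 "1 + x"] x q by simp
    have "0 \<le> q * ((1 - x) powr (q - 1) - (1 + x) powr (q - 1) - (1 - q) * x)"
      using 1 2 q by (intro mult_nonneg_nonneg) auto
    then have "0 \<le> - (q * (1 - q) * x) - q * (1 + x) powr (q - 1) + q * (1 - x) powr (q - 1)"
      by (simp add: algebra_simps)
    with D show "\<exists>y. (g has_real_derivative y) (at x) \<and> 0 \<le> y" by blast
  qed
  then show ?thesis by (simp add: g_def)
qed

text \<open>The one-coordinate case of a noise inequality: \<open>x\<close> and \<open>y\<close> are
  the means of a function on the two halves of the cube, and \<open>\<rho>\<close> damps the
  character of the new coordinate. It takes the place of the two-point hypercontractive inequality,
  following means instead of norms.\<close>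

definition two_point :: "real \<Rightarrow> real \<Rightarrow> bool" where
  "two_point \<rho> q \<longleftrightarrow> (\<forall>x\<ge>0. \<forall>y\<ge>0. ((x powr q + y powr q) / 2)\<^sup>2 + \<rho> * ((x powr q - y powr q) / 2)\<^sup>2
     \<le> ((x + y) / 2) powr (2 * q))"

text \<open>By homogeneity \<open>x = 1 + d\<close> and \<open>y = 1 - d\<close>. Concavity pushes
  the average of the powers below 1 by \<open>\<kappa> = q * (1 - q) * d\<^sup>2 / 4\<close>, and
  the damped difference costs at most \<open>\<rho> * d\<^sup>2\<close>. The choice
  \<open>1 - q = 8 * \<rho>\<close> with \<open>q \<ge> 1/2\<close> makes the loss pay for the
  cost.\<close>

lemma two_pointI:
  fixes \<rho> :: real
  assumes \<rho>: "0 \<le> \<rho>" "\<rho> \<le> 1/16"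
  shows "two_point \<rho> (1 - 8 * \<rho>)"
proof -
  define q where "q = 1 - 8 * \<rho>"
  have q: "1/2 \<le> q" "q \<le> 1" "0 < q" using \<rho> by (auto simp: q_def)
  have unit: "(((1 + d) powr q + (1 - d) powr q) / 2)\<^sup>2 + \<rho> * (((1 + d) powr q - (1 - d) powr q) / 2)\<^sup>2 \<le> 1"
    if d: "0 \<le> d" "d \<le> 1" for d
  proof -
    define \<kappa> where "\<kappa> = q * (1 - q) * d\<^sup>2 / 4"
    have d2: "0 \<le> d\<^sup>2" "d\<^sup>2 \<le> 1" using d by (auto simp: power_le_one)
    have "q * (1 - q) \<le> 1 * 1" using q by (intro mult_mono) auto
    then have "q * (1 - q) * d\<^sup>2 \<le> 1 * 1" using q d2 by (intro mult_mono) auto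
    then have \<kappa>: "0 \<le> \<kappa>" "\<kappa> \<le> 1" using q d2 by (auto simp: \<kappa>_def)
    have s: "((1 + d) powr q + (1 - d) powr q) / 2 \<le> 1 - \<kappa>"
      using powr_sum_le[OF d q(3,2)] by (simp add: \<kappa>_def)
    have "(((1 + d) powr q + (1 - d) powr q) / 2)\<^sup>2 \<le> (1 - \<kappa>)\<^sup>2"
      using s by (intro power_mono) auto
    also have "\<dots> \<le> 1 - \<kappa>" using \<kappa> by (simp add: power2_eq_square mult_left_le)
    finally have 1: "(((1 + d) powr q + (1 - d) powr q) / 2)\<^sup>2 \<le> 1 - \<kappa>" .
    have a: "(1 + d) powr q \<le> 1 + d" using powr_mono[of q 1 "1 + d"] d q by simp
    have b: "1 - d \<le> (1 - d) powr q"
      using powr_mono'[of q 1 "1 - d"] d q by (cases "d = 1") auto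
    have c: "(1 - d) powr q \<le> (1 + d) powr q" using d q by (intro powr_mono2) auto
    have "(((1 + d) powr q - (1 - d) powr q) / 2)\<^sup>2 \<le> d\<^sup>2"
      using a b c by (intro power_mono) auto
    then have "\<rho> * (((1 + d) powr q - (1 - d) powr q) / 2)\<^sup>2 \<le> \<rho> * d\<^sup>2"
      using \<rho> by (intro mult_left_mono) auto
    also have "\<rho> * d\<^sup>2 \<le> (q * (1 - q) / 4) * d\<^sup>2"
    proof (rule mult_right_mono)
      have "4 * \<rho> \<le> q * (8 * \<rho>)" using q \<rho> mult_right_mono[of "1/2" q "8 * \<rho>"] by simp
      then show "\<rho> \<le> q * (1 - q) / 4" by (simp add: q_def)
    qed simp
    finally have "\<rho> * (((1 + d) powr q - (1 - d) powr q) / 2)\<^sup>2 \<le> \<kappa>" by (simp add: \<kappa>_def)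
    with 1 show ?thesis by linarith
  qed
  have main: "((x powr q + y powr q) / 2)\<^sup>2 + \<rho> * ((x powr q - y powr q) / 2)\<^sup>2 \<le> ((x + y) / 2) powr (2 * q)"
    if xy: "0 \<le> y" "y \<le> x" for x y :: real
  proof (cases "x = 0")
    case True
    then show ?thesis using xy by simp
  next
    case False
    define a where "a = (x + y) / 2"
    define d where "d = (x - y) / (x + y)"
    have a: "a > 0" and d: "0 \<le> d" "d \<le> 1" using False xy by (auto simp: a_def d_def divide_simps)
    have x: "x = a * (1 + d)" and y: "y = a * (1 - d)"
      using False xy by (auto simp: a_def d_def field_simps)
    have px: "x powr q = a powr q * (1 + d) powr q" and py: "y powr q = a powr q * (1 - d) powr q"
      unfolding x y using a d by (auto intro!: powr_mult)
    have "((x powr q + y powr q) / 2)\<^sup>2 + \<rho> * ((x powr q - y powr q) / 2)\<^sup>2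
       = (a powr q)\<^sup>2 * ((((1 + d) powr q + (1 - d) powr q) / 2)\<^sup>2 + \<rho> * (((1 + d) powr q - (1 - d) powr q) / 2)\<^sup>2)"
      unfolding px py by (simp add: power2_eq_square field_simps)
    also have "\<dots> \<le> (a powr q)\<^sup>2 * 1" by (intro mult_left_mono unit d) auto
    also have "\<dots> = a powr (2 * q)" using a by (simp add: power2_eq_square powr_add[symmetric])
    finally show ?thesis by (simp add: a_def)
  qed
  show ?thesis
    unfolding two_point_def q_def[symmetric]
  proof (intro allI impI)
    fix x y :: real assume "0 \<le> x" "0 \<le> y"
    then show "((x powr q + y powr q) / 2)\<^sup>2 + \<rho> * ((x powr q - y powr q) / 2)\<^sup>2 \<le> ((x + y) / 2) powr (2 * q)"
      using main[of y x] main[of x y]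
      by (cases "y \<le> x") (auto simp: add.commute power2_commute[of "x powr q / 2"] diff_divide_distrib)
  qed
qed

text \<open>Equality holds here; this case yields that the squared coefficients sum to at most the
  mean.\<close>

lemma two_point_Parseval: "two_point 1 (1/2)"
  unfolding two_point_def by (auto simp: powr_half_sqrt power2_eq_square field_simps)

section \<open>Walsh functions on the cube of subsets and weighted Fourier sums\<close>

definition walsh :: "'a set \<Rightarrow> 'a set \<Rightarrow> real" where
  "walsh u x = (-1) ^ card (u \<inter> x)"

definition mean :: "'a set \<Rightarrow> ('a set \<Rightarrow> real) \<Rightarrow> real" where
  "mean X f = (\<Sum>x\<in>Pow X. f x) / 2 ^ card X"

definition fourier :: "'a set \<Rightarrow> ('a set \<Rightarrow> real) \<Rightarrow> 'a set \<Rightarrow> real" where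
  "fourier X f u = mean X (\<lambda>x. f x * walsh u x)"

lemma sum_Pow_insert:
  fixes f :: "'a set \<Rightarrow> 'b::comm_monoid_add"
  assumes "finite X" "z \<notin> X"
  shows "(\<Sum>x\<in>Pow (insert z X). f x) = (\<Sum>x\<in>Pow X. f x + f (insert z x))"
proof -
  have inj: "inj_on (insert z) (Pow X)" using assms by (auto simp: inj_on_def insert_ident)
  have "(\<Sum>x\<in>Pow (insert z X). f x) = (\<Sum>x\<in>Pow X. f x) + (\<Sum>x\<in>insert z ` Pow X. f x)"
    unfolding Pow_insert using assms by (intro sum.union_disjoint) auto
  then show ?thesis by (simp add: sum.reindex[OF inj] sum.distrib)
qed

lemma mean_insert:
  assumes "finite X" "z \<notin> X"
  shows "mean (insert z X) f = (mean X f + mean X (\<lambda>x. f (insert z x))) / 2"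
  using assms by (simp add: mean_def sum_Pow_insert sum.distrib add_divide_distrib)

lemma walsh_insert:
  assumes "finite X" "z \<notin> X" "u \<subseteq> X" "x \<subseteq> X"
  shows "walsh u (insert z x) = walsh u x" "walsh (insert z u) x = walsh u x"
    "walsh (insert z u) (insert z x) = - walsh u x"
proof -
  have z: "z \<notin> u" "z \<notin> x" "finite (u \<inter> x)" using assms by (auto intro: finite_subset)
  show "walsh u (insert z x) = walsh u x" "walsh (insert z u) x = walsh u x" using z by (auto simp: walsh_def)
  have "insert z u \<inter> insert z x = insert z (u \<inter> x)" by auto
  then show "walsh (insert z u) (insert z x) = - walsh u x" using z by (simp add: walsh_def)
qed

lemma mean_cong: "(\<And>x. x \<subseteq> X \<Longrightarrow> f x = g x) \<Longrightarrow> mean X f = mean X g"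
  by (simp add: mean_def)

lemma mean_minus: "mean X (\<lambda>x. - f x) = - mean X f"
  by (simp add: mean_def sum_negf)

lemma fourier_insert:
  assumes "finite X" "z \<notin> X" "u \<subseteq> X"
  shows "fourier (insert z X) f u = (fourier X f u + fourier X (\<lambda>x. f (insert z x)) u) / 2"
    and "fourier (insert z X) f (insert z u) = (fourier X f u - fourier X (\<lambda>x. f (insert z x)) u) / 2"
  unfolding fourier_def mean_insert[OF assms(1,2)]
  using walsh_insert[OF assms(1,2,3)]
  by (auto simp: mean_minus[symmetric] diff_conv_add_uminus simp del: add_uminus_conv_diff cong: mean_cong)

text \<open>Induction on the coordinates: the coefficients of \<open>f\<close> are half sums and
  half differences of those of its two restrictions, Cauchy--Schwarz bounds the cross term, and
  \<open>two_point\<close> closes the step. The base case uses that the values lie in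
  \<open>[0,1]\<close>.\<close>

lemma fourier_weight_le:
  assumes "finite X" "two_point \<rho> q" "0 \<le> \<rho>" "\<rho> \<le> 1" "0 < q" "q \<le> 1"
    and "\<And>x. x \<subseteq> X \<Longrightarrow> 0 \<le> f x \<and> f x \<le> 1"
  shows "(\<Sum>u\<in>Pow X. \<rho> ^ card u * (fourier X f u)\<^sup>2) \<le> mean X f powr (2 * q)"
  using assms(1,7)
proof (induction X arbitrary: f rule: finite_induct)
  case empty
  then have f: "0 \<le> f {}" "f {} \<le> 1" by auto
  have "(f {})\<^sup>2 \<le> f {} powr (2 * q)"
  proof (cases "f {} = 0")
    case False
    then have "(f {})\<^sup>2 = f {} powr 2" using f by simp
    also have "\<dots> \<le> f {} powr (2 * q)" using f assms False by (intro powr_mono') auto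
    finally show ?thesis .
  qed simp
  then show ?case by (simp add: fourier_def mean_def walsh_def)
next
  case (insert z X)
  define f1 where "f1 = (\<lambda>x. f (insert z x))"
  define a where "a = fourier X f"
  define b where "b = fourier X f1"
  define x where "x = mean X f"
  define y where "y = mean X f1"
  have f: "0 \<le> f x \<and> f x \<le> 1" if "x \<subseteq> X" for x using insert.prems[of x] that by auto
  have f1: "0 \<le> f1 x \<and> f1 x \<le> 1" if "x \<subseteq> X" for x
    using insert.prems[of "insert z x"] that by (auto simp: f1_def)
  have xy: "0 \<le> x" "0 \<le> y" unfolding x_def y_def mean_def using f f1 by (auto intro!: sum_nonneg divide_nonneg_nonneg)
  define N0 where "N0 = (\<Sum>u\<in>Pow X. \<rho> ^ card u * (a u)\<^sup>2)"
  define N1 where "N1 = (\<Sum>u\<in>Pow X. \<rho> ^ card u * (b u)\<^sup>2)"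
  define I where "I = (\<Sum>u\<in>Pow X. \<rho> ^ card u * (a u * b u))"
  have N0: "N0 \<le> (x powr q)\<^sup>2" using insert.IH[OF f]
    by (simp add: N0_def a_def x_def power2_eq_square powr_add[symmetric])
  have N1: "N1 \<le> (y powr q)\<^sup>2" using insert.IH[OF f1]
    by (simp add: N1_def b_def y_def power2_eq_square powr_add[symmetric])
  have pos: "0 \<le> N0" "0 \<le> N1" using assms by (auto simp: N0_def N1_def intro!: sum_nonneg)
  have "I = (\<Sum>u\<in>Pow X. (sqrt (\<rho> ^ card u) * a u) * (sqrt (\<rho> ^ card u) * b u))"
    unfolding I_def using assms by (intro sum.cong) (auto simp: mult_ac)
  then have "I\<^sup>2 \<le> (\<Sum>u\<in>Pow X. (sqrt (\<rho> ^ card u) * a u)\<^sup>2) * (\<Sum>u\<in>Pow X. (sqrt (\<rho> ^ card u) * b u)\<^sup>2)"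
    using Cauchy_Schwarz_ineq_sum[of "\<lambda>u. sqrt (\<rho> ^ card u) * a u" "\<lambda>u. sqrt (\<rho> ^ card u) * b u" "Pow X"] by simp
  also have "\<dots> = N0 * N1" using assms by (simp add: N0_def N1_def power_mult_distrib)
  also have "\<dots> \<le> (x powr q)\<^sup>2 * (y powr q)\<^sup>2" using N0 N1 pos by (intro mult_mono) auto
  also have "\<dots> = (x powr q * y powr q)\<^sup>2" by (simp add: power_mult_distrib)
  finally have I: "I \<le> x powr q * y powr q" by (rule power2_le_imp_le) simp
  have "(\<Sum>u\<in>Pow (insert z X). \<rho> ^ card u * (fourier (insert z X) f u)\<^sup>2)
     = (\<Sum>u\<in>Pow X. \<rho> ^ card u * ((a u + b u) / 2)\<^sup>2 + \<rho> ^ Suc (card u) * ((a u - b u) / 2)\<^sup>2)"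
    unfolding sum_Pow_insert[OF insert.hyps]
  proof (intro sum.cong refl)
    fix u assume u: "u \<in> Pow X"
    then have "card (insert z u) = Suc (card u)" using insert.hyps by (subst card_insert_disjoint) (auto intro: finite_subset)
    then show "\<rho> ^ card u * (fourier (insert z X) f u)\<^sup>2 + \<rho> ^ card (insert z u) * (fourier (insert z X) f (insert z u))\<^sup>2
      = \<rho> ^ card u * ((a u + b u) / 2)\<^sup>2 + \<rho> ^ Suc (card u) * ((a u - b u) / 2)\<^sup>2"
      using u by (simp add: fourier_insert[OF insert.hyps] a_def b_def f1_def)
  qed
  \<comment> \<open>The cross term has coefficient \<open>(1 - \<rho>) / 2\<close>, which is
    nonnegative, so an upper bound on \<open>I\<close> suffices.\<close>
  also have "\<dots> = (\<Sum>u\<in>Pow X. (1 + \<rho>) / 4 * (\<rho> ^ card u * (a u)\<^sup>2) + (1 + \<rho>) / 4 * (\<rho> ^ card u * (b u)\<^sup>2)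
        + (1 - \<rho>) / 2 * (\<rho> ^ card u * (a u * b u)))"
    by (intro sum.cong refl) (simp add: power2_eq_square field_simps)
  also have "\<dots> = (1 + \<rho>) / 4 * N0 + (1 + \<rho>) / 4 * N1 + (1 - \<rho>) / 2 * I"
    by (simp add: sum.distrib sum_distrib_left N0_def N1_def I_def)
  also have "\<dots> \<le> (1 + \<rho>) / 4 * (x powr q)\<^sup>2 + (1 + \<rho>) / 4 * (y powr q)\<^sup>2 + (1 - \<rho>) / 2 * (x powr q * y powr q)"
    using assms by (intro add_mono mult_left_mono N0 N1 I) auto
  also have "\<dots> = ((x powr q + y powr q) / 2)\<^sup>2 + \<rho> * ((x powr q - y powr q) / 2)\<^sup>2"
    by (simp add: power2_eq_square field_simps)
  also have "\<dots> \<le> ((x + y) / 2) powr (2 * q)" using assms(2) xy by (auto simp: two_point_def)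
  also have "(x + y) / 2 = mean (insert z X) f" by (simp add: mean_insert[OF insert.hyps] x_def y_def f1_def)
  finally show ?case .
qed

text \<open>For \<open>\<rho> > 1/16\<close> the damping is dropped and the Parseval case applies.
  The \<open>min\<close> merges the two cases, since the noise \<open>i / t\<close> chosen later
  ranges up to 1.\<close>

lemma level_inequality:
  assumes "finite X" "0 \<le> \<rho>" "\<rho> \<le> 1" and "\<And>x. x \<subseteq> X \<Longrightarrow> 0 \<le> f x \<and> f x \<le> 1"
  shows "(\<Sum>u\<in>Pow X. \<rho> ^ card u * (fourier X f u)\<^sup>2) \<le> mean X f powr (2 - min 1 (16 * \<rho>))"
proof (cases "\<rho> \<le> 1/16")
  case True
  then have "(\<Sum>u\<in>Pow X. \<rho> ^ card u * (fourier X f u)\<^sup>2) \<le> mean X f powr (2 * (1 - 8 * \<rho>))"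
    using assms by (intro fourier_weight_le two_pointI) auto
  also have "2 * (1 - 8 * \<rho>) = 2 - min 1 (16 * \<rho>)" using True by (simp add: min_def)
  finally show ?thesis .
next
  case False
  have "(\<Sum>u\<in>Pow X. \<rho> ^ card u * (fourier X f u)\<^sup>2) \<le> (\<Sum>u\<in>Pow X. 1 ^ card u * (fourier X f u)\<^sup>2)"
    using assms by (intro sum_mono mult_right_mono power_mono) auto
  also have "\<dots> \<le> mean X f powr (2 * (1/2))"
    using assms by (intro fourier_weight_le two_point_Parseval) auto
  also have "2 * (1/2) = 2 - min 1 (16 * \<rho>)" using False by (simp add: min_def)
  finally show ?thesis .
qed

subsection \<open>Hidden parities\<close>

lemma mean_walsh:
  assumes "finite X" "u \<subseteq> X"
  shows "mean X (walsh u) = of_bool (u = {})"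
proof (cases "u = {}")
  case True
  then show ?thesis using assms by (simp add: mean_def walsh_def card_Pow)
next
  case False
  then obtain z where z: "z \<in> u" by blast
  define X' where "X' = X - {z}"
  define u' where "u' = u - {z}"
  have X: "X = insert z X'" "z \<notin> X'" "finite X'" and u: "u = insert z u'" "u' \<subseteq> X'"
    using z assms by (auto simp: X'_def u'_def)
  have "mean X (walsh u) = (mean X' (walsh u') + mean X' (\<lambda>x. - walsh u' x)) / 2"
    unfolding X(1) u(1) mean_insert[OF X(3,2)]
    using walsh_insert[OF X(3,2) u(2)] by (simp cong: mean_cong)
  then show ?thesis using False by (simp add: mean_minus)
qed

lemma walsh_mult:
  assumes "finite u" "finite v"
  shows "walsh u x * walsh v x = walsh (sym_diff u v) x"
proof -
  have 1: "card (u \<inter> x) = card ((u - v) \<inter> x) + card (u \<inter> v \<inter> x)"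
    using assms by (subst card_Un_disjoint[symmetric]) (auto intro: arg_cong[where f = card])
  have 2: "card (v \<inter> x) = card ((v - u) \<inter> x) + card (u \<inter> v \<inter> x)"
    using assms by (subst card_Un_disjoint[symmetric]) (auto intro: arg_cong[where f = card])
  have 3: "card (sym_diff u v \<inter> x) = card ((u - v) \<inter> x) + card ((v - u) \<inter> x)"
    using assms by (subst card_Un_disjoint[symmetric]) (auto intro: arg_cong[where f = card])
  show ?thesis unfolding walsh_def 1 2 3
    by (simp add: power_add[symmetric] minus_one_power_iff)
qed

lemma prod_walsh:
  assumes "finite S" "\<And>c. c \<in> S \<Longrightarrow> finite (G c)" "disjoint_family_on G S"
  shows "(\<Prod>c\<in>S. walsh (G c) x) = walsh (\<Union>c\<in>S. G c) x"
proof -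
  have "card ((\<Union>c\<in>S. G c) \<inter> x) = card (\<Union>c\<in>S. G c \<inter> x)" by (rule arg_cong[where f = card]) auto
  also have "\<dots> = (\<Sum>c\<in>S. card (G c \<inter> x))"
    using assms by (intro card_UN_disjoint) (auto simp: disjoint_family_on_def)
  finally show ?thesis by (simp add: walsh_def power_sum)
qed

lemma mean_sum: "mean X (\<lambda>x. \<Sum>i\<in>I. f i x) = (\<Sum>i\<in>I. mean X (f i))"
  unfolding mean_def by (subst sum.swap) (simp add: sum_divide_distrib)

lemma mean_cmult: "mean X (\<lambda>x. a * f x) = a * mean X f"
  by (simp add: mean_def sum_distrib_left)

lemma mean_mono: "(\<And>x. x \<subseteq> X \<Longrightarrow> f x \<le> g x) \<Longrightarrow> mean X f \<le> mean X g"
  unfolding mean_def by (intro divide_right_mono sum_mono) auto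

lemma mean_add: "mean X (\<lambda>x. f x + g x) = mean X f + mean X g"
  by (simp add: mean_def sum.distrib add_divide_distrib)

lemma mean_const: "finite X \<Longrightarrow> mean X (\<lambda>x. a) = a"
  by (simp add: mean_def card_Pow)

text \<open>Distinct sets \<open>U S\<close> give distinct characters, so the cross terms average
  out. This is where the masks \<open>r\<close> do their work.\<close>

lemma mean_square_walsh_sum:
  assumes "finite X" "finite F" "\<And>S. S \<in> F \<Longrightarrow> U S \<subseteq> X" "inj_on U F"
  shows "mean X (\<lambda>r. (\<Sum>S\<in>F. a S * walsh (U S) r)\<^sup>2) = (\<Sum>S\<in>F. (a S)\<^sup>2)"
proof -
  have fin: "finite (U S)" if "S \<in> F" for S using assms that by (auto intro: finite_subset)
  have "mean X (\<lambda>r. (\<Sum>S\<in>F. a S * walsh (U S) r)\<^sup>2)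
      = mean X (\<lambda>r. \<Sum>S\<in>F. \<Sum>S'\<in>F. a S * a S' * walsh (sym_diff (U S) (U S')) r)"
    by (intro mean_cong) (simp add: power2_eq_square sum_product walsh_mult[symmetric] fin mult_ac)
  also have "\<dots> = (\<Sum>S\<in>F. \<Sum>S'\<in>F. a S * a S' * of_bool (S = S'))"
    unfolding mean_sum
  proof (intro sum.cong refl)
    fix S S' assume "S \<in> F" "S' \<in> F"
    then have "sym_diff (U S) (U S') = {} \<longleftrightarrow> S = S'" and "sym_diff (U S) (U S') \<subseteq> X"
      using assms(3)[of S] assms(3)[of S'] assms(4) by (auto simp: inj_on_def)
    then show "mean X (\<lambda>r. a S * a S' * walsh (sym_diff (U S) (U S')) r) = a S * a S' * of_bool (S = S')"
      using mean_walsh[OF assms(1), of "sym_diff (U S) (U S')"] by (simp add: mean_cmult)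
  qed
  also have "\<dots> = (\<Sum>S\<in>F. (a S)\<^sup>2)"
    using assms(2) by (intro sum.cong refl) (simp add: power2_eq_square of_bool_def if_distrib sum.delta' cong: if_cong)
  finally show ?thesis .
qed

section \<open>Uniform images under permutations, and sums over messages\<close>

lemma exists_permutation_image:
  assumes "finite X" "D \<subseteq> X" "u \<subseteq> X" "card u = card D"
  obtains \<tau> where "\<tau> permutes X" "\<tau> ` D = u"
proof -
  have fin: "finite D" "finite u" "finite (X - D)" "finite (X - u)" using assms by (auto intro: finite_subset)
  have "card (X - D) = card (X - u)" using assms fin by (simp add: card_Diff_subset)
  then obtain f g where f: "bij_betw f D u" and g: "bij_betw g (X - D) (X - u)"
    using assms fin by (metis finite_same_card_bij)
  define \<tau> where "\<tau> = (\<lambda>x. if x \<in> D then f x else if x \<in> X then g x else x)"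
  have 1: "bij_betw \<tau> D u" using f by (subst bij_betw_cong[of D \<tau> f]) (auto simp: \<tau>_def)
  have 2: "bij_betw \<tau> (X - D) (X - u)" using g by (subst bij_betw_cong[of "X - D" \<tau> g]) (auto simp: \<tau>_def)
  have "bij_betw \<tau> (D \<union> (X - D)) (u \<union> (X - u))"
    by (rule bij_betw_combine[OF 1 2]) auto
  then have "bij_betw \<tau> X X" using assms by (simp add: Un_absorb1)
  then have "\<tau> permutes X" using assms by (intro bij_imp_permutes) (auto simp: \<tau>_def)
  then show thesis using that 1 by (auto simp: bij_betw_def)
qed

text \<open>A uniform permutation carries \<open>D\<close> to a uniform set of the same size:
  composing with one \<open>\<tau>\<close> that carries \<open>D\<close> to \<open>u\<close> matches
  the stabiliser of \<open>D\<close> with the permutations sending \<open>D\<close> to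
  \<open>u\<close>.\<close>

lemma sum_permutations_image:
  fixes g :: "'a set \<Rightarrow> real"
  assumes X: "finite X" and D: "D \<subseteq> X"
  shows "(\<Sum>\<sigma> | \<sigma> permutes X. g (\<sigma> ` D))
    = fact (card X) / real (card X choose card D) * (\<Sum>u | u \<subseteq> X \<and> card u = card D. g u)"
proof -
  define P where "P = {\<sigma>. \<sigma> permutes X}"
  define C where "C = {u. u \<subseteq> X \<and> card u = card D}"
  have finP: "finite P" "card P = fact (card X)" using X by (auto simp: P_def finite_permutations card_permutations)
  have finC: "finite C" "card C = card X choose card D" using X by (auto simp: C_def n_subsets)
  define K where "K = card {\<sigma>\<in>P. \<sigma> ` D = D}"
  have K: "card {\<sigma>\<in>P. \<sigma> ` D = u} = K" if "u \<in> C" for u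
  proof -
    from that have "u \<subseteq> X" "card u = card D" by (auto simp: C_def)
    then obtain \<tau> where \<tau>: "\<tau> permutes X" "\<tau> ` D = u"
      by (rule exists_permutation_image[OF X D])
    have inv: "inv \<tau> ` u = D" using \<tau> by (metis image_inv_f_f permutes_inj)
    have "bij_betw (\<lambda>\<sigma>. \<tau> \<circ> \<sigma>) {\<sigma>\<in>P. \<sigma> ` D = D} {\<sigma>\<in>P. \<sigma> ` D = u}"
    proof (rule bij_betwI[where g = "\<lambda>\<sigma>. inv \<tau> \<circ> \<sigma>"])
      show "(\<lambda>\<sigma>. \<tau> \<circ> \<sigma>) \<in> {\<sigma>\<in>P. \<sigma> ` D = D} \<rightarrow> {\<sigma>\<in>P. \<sigma> ` D = u}"
        using \<tau> unfolding P_def by (auto simp: permutes_compose image_comp[symmetric] simp del: image_comp o_apply)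
      show "(\<lambda>\<sigma>. inv \<tau> \<circ> \<sigma>) \<in> {\<sigma>\<in>P. \<sigma> ` D = u} \<rightarrow> {\<sigma>\<in>P. \<sigma> ` D = D}"
        using \<tau>(1) inv unfolding P_def by (auto simp: permutes_compose permutes_inv image_comp[symmetric] simp del: image_comp o_apply)
    qed (simp_all add: o_assoc permutes_inv_o[OF \<tau>(1)])
    from bij_betw_same_card[OF this] show ?thesis unfolding K_def by (rule sym)
  qed
  have im: "\<sigma> ` D \<in> C" if "\<sigma> \<in> P" for \<sigma>
    using that D permutes_image[of \<sigma> X] permutes_inj_on[of \<sigma> X D]
    by (auto simp: P_def C_def card_image)
  have "(\<Sum>\<sigma>\<in>P. f (\<sigma> ` D)) = (\<Sum>u\<in>C. real K * f u)" for f :: "'a set \<Rightarrow> real"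
  proof -
    have "(\<Sum>\<sigma>\<in>P. f (\<sigma> ` D)) = (\<Sum>u\<in>C. \<Sum>\<sigma>\<in>{\<sigma>\<in>P. \<sigma> ` D = u}. f (\<sigma> ` D))"
      by (rule sum.group[symmetric]) (use finP finC im in auto)
    also have "\<dots> = (\<Sum>u\<in>C. real K * f u)" by (intro sum.cong refl) (simp add: K)
    finally show ?thesis .
  qed
  note main = this
  \<comment> \<open>The constant function 1 determines the common fibre size \<open>K\<close>
    without counting a stabiliser.\<close>
  have "fact (card X) = real K * real (card C)" using main[of "\<lambda>_. 1"] finP by (simp add: mult.commute)
  moreover have "card C \<noteq> 0" using finC card_mono[OF X D] by simp
  ultimately have "real K = fact (card X) / real (card X choose card D)" using finC by (simp add: field_simps)
  then show ?thesis using main[of g] by (simp add: P_def C_def sum_distrib_left)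
qed

text \<open>Jensen's inequality for \<open>y powr (1 - e)\<close>, obtained from the weighted
  arithmetic-geometric mean inequality after scaling the densities by \<open>card M\<close> to
  average 1.\<close>

lemma sum_powr_le:
  fixes \<mu> :: "'m \<Rightarrow> real"
  assumes M: "finite M" "M \<noteq> {}" and \<mu>: "\<And>m. m \<in> M \<Longrightarrow> 0 \<le> \<mu> m" "(\<Sum>m\<in>M. \<mu> m) = 1" and e: "0 \<le> e" "e \<le> 1"
  shows "(\<Sum>m\<in>M. \<mu> m powr (1 - e)) \<le> real (card M) powr e"
proof -
  define N where "N = real (card M)"
  have N: "N > 0" using M by (auto simp: N_def card_gt_0_iff)
  have young: "y powr (1 - e) \<le> (1 - e) * y + e" if "0 \<le> y" for y
  proof (cases "y = 0")
    case False
    then have y: "y > 0" using that by simp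
    have "(1 - e) * ln y + e * ln 1 \<le> ln ((1 - e) * y + e * 1)"
      using concave_onD[OF ln_concave, of "e" y 1] y e by simp
    then have "ln (y powr (1 - e)) \<le> ln ((1 - e) * y + e)" using y by (simp add: ln_powr)
    moreover have "(1 - e) * y + e > 0" using y e by (cases "e = 0") (auto intro: add_nonneg_pos)
    ultimately show ?thesis using y by (subst (asm) ln_le_cancel_iff) auto
  qed (use e in simp)
  have "\<mu> m powr (1 - e) = N powr (e - 1) * (N * \<mu> m) powr (1 - e)" if "m \<in> M" for m
    using that N \<mu>(1)[OF that] by (simp add: powr_mult mult.assoc[symmetric] powr_add[symmetric])
  then have "(\<Sum>m\<in>M. \<mu> m powr (1 - e)) = (\<Sum>m\<in>M. N powr (e - 1) * (N * \<mu> m) powr (1 - e))" by simp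
  also have "\<dots> \<le> (\<Sum>m\<in>M. N powr (e - 1) * ((1 - e) * (N * \<mu> m) + e))"
    using N \<mu> by (intro sum_mono mult_left_mono young) auto
  also have "\<dots> = N powr (e - 1) * ((1 - e) * N * (\<Sum>m\<in>M. \<mu> m) + e * N)"
    by (simp add: sum_distrib_left[symmetric] sum.distrib N_def mult.assoc mult.commute[of e])
  also have "\<dots> = N powr (e - 1) * N" using \<mu>(2) by (simp add: algebra_simps)
  also have "\<dots> = N powr e" using N powr_add[of N "e - 1" 1] by simp
  finally show ?thesis by (simp add: N_def)
qed

lemma sum_Pow_power_card_le:
  fixes z :: real
  assumes "0 \<le> z" "real t * z \<le> 1/800"
  shows "(\<Sum>S\<in>Pow {..<t} - {{}}. z ^ card S) \<le> 1/400"
proof -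
  have "(\<Sum>S\<in>Pow {..<t}. z ^ card S) = (1 + z) ^ t"
    using prod_add[of "{..<t}" "\<lambda>_. z" "\<lambda>_. 1"] by (simp add: add.commute)
  also have "\<dots> \<le> exp z ^ t" using assms exp_ge_add_one_self[of z] by (intro power_mono) auto
  also have "\<dots> = exp (real t * z)" by (simp add: exp_of_nat_mult)
  also have "\<dots> \<le> 1 + real t * z + (real t * z)\<^sup>2" using assms by (intro exp_bound) auto
  also have "(real t * z)\<^sup>2 \<le> real t * z" using assms by (auto simp: power2_eq_square intro!: mult_left_le)
  finally have "(\<Sum>S\<in>Pow {..<t}. z ^ card S) \<le> 1 + 1/400" using assms by linarith
  then show ?thesis by (simp add: sum_diff1)
qed

text \<open>Sets of even size cancel, in particular the empty one, so every surviving character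
  involves some hidden parity.\<close>

lemma prod_diff_expand:
  fixes s :: "nat \<Rightarrow> real"
  shows "(\<Prod>c<t. 1 - s c) - (\<Prod>c<t. 1 + s c) = (\<Sum>S | S \<subseteq> {..<t} \<and> odd (card S). - 2 * (\<Prod>c\<in>S. s c))"
proof -
  have "(\<Prod>c<t. 1 - s c) = (\<Sum>S\<in>Pow {..<t}. (-1) ^ card S * (\<Prod>c\<in>S. s c))"
    using prod_add[of "{..<t}" "\<lambda>c. - s c" "\<lambda>_. 1"] by (simp add: prod_uminus)
  moreover have "(\<Prod>c<t. 1 + s c) = (\<Sum>S\<in>Pow {..<t}. \<Prod>c\<in>S. s c)"
    using prod_add[of "{..<t}" s "\<lambda>_. 1"] by (simp add: add.commute)
  ultimately have "(\<Prod>c<t. 1 - s c) - (\<Prod>c<t. 1 + s c)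
      = (\<Sum>S\<in>Pow {..<t}. if odd (card S) then - 2 * (\<Prod>c\<in>S. s c) else 0)"
    by (auto simp: sum_subtractf[symmetric] intro!: sum.cong)
  also have "\<dots> = (\<Sum>S\<in>{S\<in>Pow {..<t}. odd (card S)}. - 2 * (\<Prod>c\<in>S. s c))"
    by (rule sum.inter_filter[symmetric]) simp
  finally show ?thesis by (simp add: Pow_def)
qed

text \<open>The factor \<open>s c\<close> is the sign of the parity of double cycle \<open>c\<close>, so the difference of products is \<open>2 ^ t\<close>
  times the indicator of "all parities odd" minus that of "all parities even".\<close>

lemma hidden_parity_advantage_le:
  fixes G :: "nat \<Rightarrow> 'a set" and t h :: nat and \<beta> :: "'m \<Rightarrow> ('a \<Rightarrow> 'a) \<Rightarrow> 'a set \<Rightarrow> real"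
    and \<kappa> :: "nat \<Rightarrow> real"
  defines "s \<equiv> (\<lambda>\<sigma> r x c. \<kappa> c * walsh (G c) r * walsh (\<sigma> ` G c) x)"
  assumes X: "finite X" "card X = 2 * t * h" and th: "t > 0" "h > 0"
    and G: "\<And>c. c < t \<Longrightarrow> G c \<subseteq> X" "\<And>c. c < t \<Longrightarrow> card (G c) = h" "disjoint_family_on G {..<t}"
    and M: "finite M" "\<And>x. x \<subseteq> X \<Longrightarrow> msg x \<in> M" "real (card M) \<le> 2 powr (real h * real t / 64)"
    and small: "real t * 2 powr (- 3 * real h / 4) \<le> 1/800"
    and \<beta>: "\<And>m \<sigma> r. 0 \<le> \<beta> m \<sigma> r \<and> \<beta> m \<sigma> r \<le> 1"
    and \<kappa>: "\<And>c. \<bar>\<kappa> c\<bar> = 1"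
  shows "(\<Sum>\<sigma> | \<sigma> permutes X. mean X (\<lambda>r. mean X (\<lambda>x. \<beta> (msg x) \<sigma> r *
            ((\<Prod>c<t. 1 - s \<sigma> r x c) - (\<Prod>c<t. 1 + s \<sigma> r x c))))) \<le> fact (card X) / 10"
proof -
  define P where "P = {\<sigma>. \<sigma> permutes X}"
  define F where "F = {S. S \<subseteq> {..<t} \<and> odd (card S)}"
  define U where "U = (\<lambda>S. \<Union>c\<in>S. G c)"
  define f where "f = (\<lambda>m x. of_bool (msg x = m) :: real)"
  define \<mu> where "\<mu> = (\<lambda>m. mean X (f m))"
  define K where "K = (\<lambda>S. \<Prod>c\<in>S. \<kappa> c)"
  \<comment> \<open>For a fixed message and fixed positions, \<open>- 2 * Z\<close> will be the mean
    over \<open>x\<close> of the message's indicator times the difference of products, expanded in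
    the mask \<open>r\<close>.\<close>
  define Z where "Z = (\<lambda>m \<sigma> r. \<Sum>S\<in>F. (K S * fourier X (f m) (\<sigma> ` U S)) * walsh (U S) r)"
  have finF: "finite F" by (rule finite_subset[of _ "Pow {..<t}"]) (auto simp: F_def)
  have finP: "finite P" "card P = fact (card X)" using X by (auto simp: P_def finite_permutations card_permutations)
  have finG: "finite (G c)" if "c < t" for c using G(1)[OF that] X(1) finite_subset by auto
  have finS: "finite S" if "S \<in> F" for S using that by (auto simp: F_def intro: finite_subset)
  have dS: "disjoint_family_on G S" if "S \<in> F" for S
    using G(3) that by (auto simp: F_def disjoint_family_on_def)
  have US: "U S \<subseteq> X" if "S \<in> F" for S using G(1) that by (auto simp: F_def U_def)
  have cardU: "card (U S) = h * card S" if S: "S \<in> F" for S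
  proof -
    have "card (U S) = (\<Sum>c\<in>S. card (G c))" unfolding U_def
      using finS[OF S] dS[OF S] S finG by (intro card_UN_disjoint) (auto simp: F_def disjoint_family_on_def)
    also have "\<dots> = (\<Sum>c\<in>S. h)" using S G(2) by (intro sum.cong) (auto simp: F_def)
    finally show ?thesis by simp
  qed
  have injU: "inj_on U F"
  proof (rule inj_onI)
    fix S S' assume S: "S \<in> F" "S' \<in> F" and eq: "U S = U S'"
    have *: "A \<subseteq> B" if "A \<in> F" "B \<in> F" "U A = U B" for A B
    proof
      fix c assume c: "c \<in> A"
      then have ct: "c < t" using that by (auto simp: F_def)
      then obtain y where y: "y \<in> G c" using G(2)[OF ct] th finG[OF ct] by fastforce
      then have "y \<in> U B" using c that(3)[symmetric] by (auto simp: U_def)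
      then obtain c' where c': "c' \<in> B" "y \<in> G c'" by (auto simp: U_def)
      then have "c' < t" using that by (auto simp: F_def)
      then have "c = c'" using G(3) y c' ct by (auto simp: disjoint_family_on_def)
      then show "c \<in> B" using c' by simp
    qed
    show "S = S'" using *[of S S'] *[of S' S] S eq by auto
  qed
  have K2: "(K S)\<^sup>2 = 1" for S
  proof -
    have "\<bar>K S\<bar> = 1" using \<kappa> by (simp add: K_def abs_prod)
    then show ?thesis by (metis power2_abs one_power2)
  qed
  have f01: "0 \<le> f m x \<and> f m x \<le> 1" for m x by (auto simp: f_def)
  have \<mu>0: "0 \<le> \<mu> m" for m using f01 by (auto simp: \<mu>_def mean_def intro!: divide_nonneg_nonneg sum_nonneg)
  have Mne: "M \<noteq> {}" using M(2)[of "{}"] by auto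
  have sumf: "(\<Sum>m\<in>M. f m x * g m) = g (msg x)" if "x \<subseteq> X" for x and g :: "'m \<Rightarrow> real"
  proof -
    have "(\<Sum>m\<in>M. f m x * g m) = (\<Sum>m\<in>M. if msg x = m then g m else 0)"
      by (intro sum.cong) (auto simp: f_def)
    then show ?thesis using M(1) M(2)[OF that] by simp
  qed
  have sum\<mu>: "(\<Sum>m\<in>M. \<mu> m) = 1"
  proof -
    have "(\<Sum>m\<in>M. \<mu> m) = mean X (\<lambda>x. \<Sum>m\<in>M. f m x * 1)" by (simp add: \<mu>_def mean_sum)
    also have "\<dots> = mean X (\<lambda>x. 1)" by (intro mean_cong sumf)
    finally show ?thesis using X by (simp add: mean_const)
  qed
  \<comment> \<open>Bob's decision \<open>\<beta>\<close> sees \<open>x\<close> only through the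
    message, so splitting by messages turns the mean over \<open>x\<close> into Fourier coefficients
    of the message classes.\<close>
  have inner: "mean X (\<lambda>x. \<beta> (msg x) \<sigma> r * ((\<Prod>c<t. 1 - s \<sigma> r x c) - (\<Prod>c<t. 1 + s \<sigma> r x c)))
      = (\<Sum>m\<in>M. \<beta> m \<sigma> r * (- 2 * Z m \<sigma> r))" if \<sigma>: "\<sigma> \<in> P" for \<sigma> r
  proof -
    have ps: "(\<Prod>c\<in>S. s \<sigma> r x c) = K S * walsh (U S) r * walsh (\<sigma> ` U S) x" if S: "S \<in> F" for S x
    proof -
      have inj: "inj \<sigma>" using \<sigma> by (auto simp: P_def permutes_inj)
      have "disjoint_family_on (\<lambda>c. \<sigma> ` G c) S"
        using dS[OF S] inj by (auto simp: disjoint_family_on_def image_Int[symmetric])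
      moreover have "finite (G c)" if "c \<in> S" for c using S that finG by (auto simp: F_def)
      ultimately show ?thesis
        using prod_walsh[OF finS[OF S], of G r] prod_walsh[OF finS[OF S], of "\<lambda>c. \<sigma> ` G c" x] dS[OF S]
        by (simp add: s_def prod.distrib K_def U_def image_UN)
    qed
    have "mean X (\<lambda>x. \<beta> (msg x) \<sigma> r * ((\<Prod>c<t. 1 - s \<sigma> r x c) - (\<Prod>c<t. 1 + s \<sigma> r x c)))
       = mean X (\<lambda>x. \<Sum>m\<in>M. f m x * (\<beta> m \<sigma> r * (\<Sum>S\<in>F. - 2 * (K S * walsh (U S) r * walsh (\<sigma> ` U S) x))))"
    proof (rule mean_cong)
      fix x assume x: "x \<subseteq> X"
      show "\<beta> (msg x) \<sigma> r * ((\<Prod>c<t. 1 - s \<sigma> r x c) - (\<Prod>c<t. 1 + s \<sigma> r x c))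
        = (\<Sum>m\<in>M. f m x * (\<beta> m \<sigma> r * (\<Sum>S\<in>F. - 2 * (K S * walsh (U S) r * walsh (\<sigma> ` U S) x))))"
        unfolding sumf[OF x] prod_diff_expand F_def[symmetric] by (simp add: ps)
    qed
    also have "\<dots> = (\<Sum>m\<in>M. \<Sum>S\<in>F. mean X (\<lambda>x. (\<beta> m \<sigma> r * (- 2 * (K S * walsh (U S) r))) * (f m x * walsh (\<sigma> ` U S) x)))"
      unfolding mean_sum[symmetric] by (intro mean_cong sum.cong refl) (simp add: sum_distrib_left mult_ac)
    also have "\<dots> = (\<Sum>m\<in>M. \<beta> m \<sigma> r * (- 2 * Z m \<sigma> r))"
      unfolding mean_cmult fourier_def[symmetric] Z_def
      by (intro sum.cong refl) (simp add: sum_distrib_left mult_ac)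
    finally show ?thesis .
  qed
  \<comment> \<open>For a message of density 0 the quotient \<open>20 / \<mu> m\<close> is 0, so the
    next estimate requires \<open>Z\<close> to vanish.\<close>
  have Z0: "Z m \<sigma> r = 0" if "\<mu> m = 0" for m \<sigma> r
  proof -
    have "(\<Sum>x\<in>Pow X. f m x) = 0" using that X by (simp add: \<mu>_def mean_def)
    then have "\<forall>x\<in>Pow X. f m x = 0" using X f01 by (subst (asm) sum_nonneg_eq_0_iff) auto
    then have "fourier X (f m) u = 0" for u by (simp add: fourier_def mean_def)
    then show ?thesis by (simp add: Z_def)
  qed
  \<comment> \<open>Completing the square instead of applying Cauchy--Schwarz keeps square roots out of the sums over messages.\<close>
  have amgm: "\<beta> m \<sigma> r * (- 2 * Z m \<sigma> r) \<le> \<mu> m / 20 + 20 / \<mu> m * (Z m \<sigma> r)\<^sup>2" for m \<sigma> r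
  proof -
    have "\<beta> m \<sigma> r * (- 2 * Z m \<sigma> r) \<le> \<bar>\<beta> m \<sigma> r * (- 2 * Z m \<sigma> r)\<bar>" by simp
    also have "\<dots> \<le> 1 * (2 * \<bar>Z m \<sigma> r\<bar>)" using \<beta> unfolding abs_mult by (intro mult_mono) auto
    also have "\<dots> \<le> \<mu> m / 20 + 20 / \<mu> m * (Z m \<sigma> r)\<^sup>2"
    proof (cases "\<mu> m = 0")
      case False
      then have m: "\<mu> m > 0" using \<mu>0[of m] by simp
      have "0 \<le> (\<mu> m / 20 - \<bar>Z m \<sigma> r\<bar>)\<^sup>2 * (20 / \<mu> m)" using m by simp
      also have "\<dots> = \<mu> m / 20 + 20 / \<mu> m * (Z m \<sigma> r)\<^sup>2 - 2 * \<bar>Z m \<sigma> r\<bar>"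
        using m by (simp add: power2_diff power2_eq_square[of "\<mu> m"] field_simps)
      finally show ?thesis by simp
    qed (simp add: Z0)
    finally show ?thesis .
  qed
  have level: "(\<Sum>\<sigma>\<in>P. (fourier X (f m) (\<sigma> ` U S))\<^sup>2)
      \<le> fact (card X) * (2 powr (- real (h * card S)) * \<mu> m powr (2 - min 1 (16 * (real (card S) / real t))))"
    if S: "S \<in> F" for m S
  proof -
    define i where "i = card S"
    \<comment> \<open>The noise is matched to the binomial coefficient:
      \<open>card X / (h * i)\<close> equals \<open>2 / \<rho>\<close>, so the number of sets of
      size \<open>h * i\<close> beats the damping \<open>\<rho> ^ (h * i)\<close> by
      \<open>2 ^ (h * i)\<close>.\<close>
    define \<rho> where "\<rho> = real i / real t"
    have "i \<le> t" using S card_mono[of "{..<t}" S] by (auto simp: i_def F_def)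
    moreover have "i > 0" using S by (auto simp: i_def F_def intro: Nat.gr0I)
    ultimately have i: "0 < i" "i \<le> t" by auto
    then have \<rho>: "0 < \<rho>" "\<rho> \<le> 1" by (auto simp: \<rho>_def)
    have hi: "h * i \<le> card X" using i X th mult_le_mono[of h h i "2 * t"] by (simp add: mult_ac)
    define b where "b = real (card X choose (h * i))"
    have b0: "b > 0" using hi by (simp add: b_def)
    have "(2 / \<rho>) ^ (h * i) = (real (card X) / real (h * i)) ^ (h * i)"
      using i th by (simp add: X(2) \<rho>_def field_simps)
    also have "\<dots> \<le> b" unfolding b_def by (rule binomial_ge_n_over_k_pow_k[OF hi])
    finally have b: "2 ^ (h * i) \<le> b * \<rho> ^ (h * i)" using \<rho> by (simp add: power_divide field_simps)
    have "\<rho> ^ (h * i) * (\<Sum>u | u \<subseteq> X \<and> card u = h * i. (fourier X (f m) u)\<^sup>2)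
       = (\<Sum>u | u \<subseteq> X \<and> card u = h * i. \<rho> ^ card u * (fourier X (f m) u)\<^sup>2)"
      by (simp add: sum_distrib_left)
    also have "\<dots> \<le> (\<Sum>u\<in>Pow X. \<rho> ^ card u * (fourier X (f m) u)\<^sup>2)"
      using X \<rho> by (intro sum_mono2) auto
    also have "\<dots> \<le> \<mu> m powr (2 - min 1 (16 * \<rho>))"
      unfolding \<mu>_def using X \<rho> f01 by (intro level_inequality) auto
    finally have lev: "\<rho> ^ (h * i) * (\<Sum>u | u \<subseteq> X \<and> card u = h * i. (fourier X (f m) u)\<^sup>2) \<le> \<mu> m powr (2 - min 1 (16 * \<rho>))" .
    define W where "W = (\<Sum>u | u \<subseteq> X \<and> card u = h * i. (fourier X (f m) u)\<^sup>2)"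
    have W: "W \<ge> 0" unfolding W_def by (intro sum_nonneg) auto
    have "2 ^ (h * i) * W \<le> b * (\<rho> ^ (h * i) * W)" using mult_right_mono[OF b W] by (simp add: mult_ac)
    also have "\<dots> \<le> b * \<mu> m powr (2 - min 1 (16 * \<rho>))" using lev b0 by (intro mult_left_mono) (auto simp: W_def)
    finally have "W / b \<le> 2 powr (- real (h * i)) * \<mu> m powr (2 - min 1 (16 * \<rho>))"
      using b0 by (simp add: powr_minus powr_realpow[symmetric] field_simps del: of_nat_mult)
    then have "fact (card X) * (W / b) \<le> fact (card X) * (2 powr (- real (h * i)) * \<mu> m powr (2 - min 1 (16 * \<rho>)))"
      by (intro mult_left_mono) auto
    then show ?thesis
      using sum_permutations_image[OF X(1) US[OF S], of "\<lambda>u. (fourier X (f m) u)\<^sup>2"] cardU[OF S]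
      by (simp add: P_def W_def b_def i_def \<rho>_def del: of_nat_mult)
  qed
  have Msum: "(\<Sum>m\<in>M. \<mu> m powr (1 - min 1 (16 * (real (card S) / real t)))) \<le> 2 powr (real (h * card S) / 4)"
    if S: "S \<in> F" for S
  proof -
    define e where "e = min 1 (16 * (real (card S) / real t))"
    have e: "0 \<le> e" "e \<le> 1" "e \<le> 16 * (real (card S) / real t)" by (auto simp: e_def)
    have "(\<Sum>m\<in>M. \<mu> m powr (1 - e)) \<le> real (card M) powr e"
      using M(1) Mne \<mu>0 sum\<mu> e by (intro sum_powr_le) auto
    also have "\<dots> \<le> (2 powr (real h * real t / 64)) powr e" using M(3) e by (intro powr_mono2) auto
    also have "\<dots> = 2 powr (real h * real t / 64 * e)" by (simp add: powr_powr)
    also have "\<dots> \<le> 2 powr (real h * real t / 64 * (16 * (real (card S) / real t)))"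
      using e by (intro powr_mono mult_left_mono) auto
    \<comment> \<open>The 16 of the level inequality against the 64 of the message length leaves
      \<open>1/4\<close>.\<close>
    also have "\<dots> = 2 powr (real (h * card S) / 4)" using th by simp
    finally show ?thesis by (simp add: e_def)
  qed
  have "(\<Sum>\<sigma>\<in>P. mean X (\<lambda>r. mean X (\<lambda>x. \<beta> (msg x) \<sigma> r *
            ((\<Prod>c<t. 1 - s \<sigma> r x c) - (\<Prod>c<t. 1 + s \<sigma> r x c)))))
      = (\<Sum>\<sigma>\<in>P. mean X (\<lambda>r. \<Sum>m\<in>M. \<beta> m \<sigma> r * (- 2 * Z m \<sigma> r)))"
    by (intro sum.cong refl mean_cong inner)
  also have "\<dots> \<le> (\<Sum>\<sigma>\<in>P. mean X (\<lambda>r. \<Sum>m\<in>M. \<mu> m / 20 + 20 / \<mu> m * (Z m \<sigma> r)\<^sup>2))"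
    by (intro sum_mono mean_mono amgm)
  also have "\<dots> = (\<Sum>\<sigma>\<in>P. \<Sum>m\<in>M. \<mu> m / 20 + 20 / \<mu> m * (\<Sum>S\<in>F. (fourier X (f m) (\<sigma> ` U S))\<^sup>2))"
  proof (intro sum.cong refl)
    fix \<sigma> assume "\<sigma> \<in> P"
    have "mean X (\<lambda>r. (Z m \<sigma> r)\<^sup>2) = (\<Sum>S\<in>F. (fourier X (f m) (\<sigma> ` U S))\<^sup>2)" for m
      unfolding Z_def using mean_square_walsh_sum[OF X(1) finF US injU, of "\<lambda>S. K S * fourier X (f m) (\<sigma> ` U S)"]
      by (simp add: power_mult_distrib K2)
    then show "mean X (\<lambda>r. \<Sum>m\<in>M. \<mu> m / 20 + 20 / \<mu> m * (Z m \<sigma> r)\<^sup>2)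
        = (\<Sum>m\<in>M. \<mu> m / 20 + 20 / \<mu> m * (\<Sum>S\<in>F. (fourier X (f m) (\<sigma> ` U S))\<^sup>2))"
      by (simp only: mean_sum mean_add mean_cmult mean_const[OF X(1)])
  qed
  also have "\<dots> = (\<Sum>m\<in>M. \<Sum>\<sigma>\<in>P. \<mu> m / 20 + 20 / \<mu> m * (\<Sum>S\<in>F. (fourier X (f m) (\<sigma> ` U S))\<^sup>2))"
    by (rule sum.swap)
  also have "\<dots> = (\<Sum>m\<in>M. fact (card X) * (\<mu> m / 20) + 20 / \<mu> m * (\<Sum>S\<in>F. \<Sum>\<sigma>\<in>P. (fourier X (f m) (\<sigma> ` U S))\<^sup>2))"
    unfolding sum.distrib sum_distrib_left[symmetric] sum.swap[of _ P F] by (simp add: finP sum_distrib_left)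
  also have "\<dots> \<le> (\<Sum>m\<in>M. fact (card X) * (\<mu> m / 20) + 20 * (\<Sum>S\<in>F. fact (card X) * (2 powr (- real (h * card S)) *
      \<mu> m powr (1 - min 1 (16 * (real (card S) / real t))))))"
  proof (intro sum_mono add_left_mono)
    fix m
    show "20 / \<mu> m * (\<Sum>S\<in>F. \<Sum>\<sigma>\<in>P. (fourier X (f m) (\<sigma> ` U S))\<^sup>2)
      \<le> 20 * (\<Sum>S\<in>F. fact (card X) * (2 powr (- real (h * card S)) * \<mu> m powr (1 - min 1 (16 * (real (card S) / real t)))))"
    proof (cases "\<mu> m = 0")
      case False
      then have m: "\<mu> m > 0" using \<mu>0[of m] by simp
      have dv: "\<mu> m powr (2 - e) / \<mu> m = \<mu> m powr (1 - e)" for e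
        using m powr_diff[of "\<mu> m" "2 - e" 1] by simp
      have "20 / \<mu> m * (\<Sum>S\<in>F. \<Sum>\<sigma>\<in>P. (fourier X (f m) (\<sigma> ` U S))\<^sup>2)
        \<le> 20 / \<mu> m * (\<Sum>S\<in>F. fact (card X) * (2 powr (- real (h * card S)) * \<mu> m powr (2 - min 1 (16 * (real (card S) / real t)))))"
        using m by (intro mult_left_mono sum_mono level) auto
      also have "\<dots> = 20 * (\<Sum>S\<in>F. fact (card X) * (2 powr (- real (h * card S)) * (\<mu> m powr (2 - min 1 (16 * (real (card S) / real t))) / \<mu> m)))"
        by (simp add: sum_distrib_left field_simps)
      also have "\<dots> = 20 * (\<Sum>S\<in>F. fact (card X) * (2 powr (- real (h * card S)) * \<mu> m powr (1 - min 1 (16 * (real (card S) / real t)))))"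
        unfolding dv ..
      finally show ?thesis .
    qed simp
  qed
  also have "\<dots> = fact (card X) * ((\<Sum>m\<in>M. \<mu> m) / 20) + 20 * (\<Sum>S\<in>F. fact (card X) * (2 powr (- real (h * card S)) *
      (\<Sum>m\<in>M. \<mu> m powr (1 - min 1 (16 * (real (card S) / real t))))))"
  proof -
    define A where "A = (\<lambda>m (S :: nat set). 2 powr (- real (h * card S)) * \<mu> m powr (1 - min 1 (16 * (real (card S) / real t))))"
    have "(\<Sum>m\<in>M. fact (card X) * (\<mu> m / 20) + 20 * (\<Sum>S\<in>F. fact (card X) * A m S))
        = (\<Sum>m\<in>M. fact (card X) * (\<mu> m / 20)) + 20 * (\<Sum>S\<in>F. \<Sum>m\<in>M. fact (card X) * A m S)"
      unfolding sum.distrib sum_distrib_left[symmetric] sum.swap[of _ M F] by simp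
    then show ?thesis by (simp add: A_def sum_distrib_left sum_divide_distrib)
  qed
  also have "\<dots> \<le> fact (card X) * (1 / 20) + 20 * (\<Sum>S\<in>F. fact (card X) * (2 powr (- real (h * card S)) * 2 powr (real (h * card S) / 4)))"
    using sum\<mu> by (intro add_mono mult_left_mono sum_mono Msum) auto
  also have "\<dots> = fact (card X) * (1 / 20 + 20 * (\<Sum>S\<in>F. (2 powr (- 3 * real h / 4)) ^ card S))"
    by (simp add: sum_distrib_left powr_add[symmetric] powr_realpow[symmetric] powr_powr algebra_simps del: of_nat_mult)
       (simp add: algebra_simps)
  \<comment> \<open>The weight 20 in \<open>amgm\<close> balances the two parts: each contributes
    \<open>1/20\<close>.\<close>
  also have "\<dots> \<le> fact (card X) * (1 / 20 + 20 * (1/400))"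
  proof (intro mult_left_mono add_left_mono)
    have "(\<Sum>S\<in>F. (2 powr (- 3 * real h / 4)) ^ card S) \<le> (\<Sum>S\<in>Pow {..<t} - {{}}. (2 powr (- 3 * real h / 4)) ^ card S)"
      by (intro sum_mono2) (auto simp: F_def)
    also have "\<dots> \<le> 1/400" using small by (intro sum_Pow_power_card_le) auto
    finally show "(\<Sum>S\<in>F. (2 powr (- 3 * real h / 4)) ^ card S) \<le> 1/400" .
  qed auto
  finally show ?thesis by (simp add: P_def)
qed

subsection \<open>Graphs from twisted double cycles and double paths\<close>

text \<open>Disjointness by counting: lists of total length \<open>n\<close> that cover
  \<open>n\<close> vertices cannot repeat one.\<close>

lemma disjoint_cycles_pathsI:
  assumes "length cs = a" "\<forall>c\<in>set cs. length c = l" "length ps = b" "\<forall>p\<in>set ps. length p = m + 1"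
    and n: "a * l + b * (m + 1) = n" and cover: "set (concat (cs @ ps)) = {..<n}"
    and E: "E = (\<Union>c\<in>set cs. cycle_edges c) \<union> (\<Union>p\<in>set ps. path_edges p)"
  shows "disjoint_cycles_paths n a l b m E"
proof -
  have "map length cs = replicate a l" "map length ps = replicate b (m + 1)"
    using assms(1-4) by (auto intro!: replicate_eqI)
  then have "length (concat (cs @ ps)) = n"
    using n unfolding length_concat by (simp add: sum_list_replicate)
  then have "distinct (concat (cs @ ps))" using cover by (intro card_distinct) simp
  then show ?thesis unfolding disjoint_cycles_paths_def using assms by blast
qed

lemma cycle_edges_map:
  assumes "v l = v 0"
  shows "cycle_edges (map v [0..<l]) = {{v i, v (Suc i)} | i. i < l}"
proof -
  have "map v [0..<l] ! (Suc i mod l) = v (Suc i)" if "i < l" for i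
    using that assms by (cases "Suc i = l") auto
  then have "{map v [0..<l] ! i, map v [0..<l] ! (Suc i mod l)} = {v i, v (Suc i)}" if "i < l" for i
    using that by simp
  then show ?thesis unfolding cycle_edges_def setcompr_eq_image by (intro image_cong) auto
qed

lemma path_edges_map: "path_edges (map v [0..<l]) = {{v i, v (Suc i)} | i. Suc i < l}"
proof -
  have "{map v [0..<l] ! i, map v [0..<l] ! Suc i} = {v i, v (Suc i)}" if "Suc i < l" for i
    using that by (simp add: nth_append)
  then show ?thesis unfolding path_edges_def by force
qed

locale layers =
  fixes t k :: nat
  assumes t: "0 < t" and k: "3 \<le> k"
begin

text \<open>Slot \<open>(c, j)\<close> is the \<open>j\<close>-th position of component \<open>c\<close>; the components \<open>c < t\<close> are the double cycles.
  A permutation \<open>\<phi>\<close> of the slots tells which layer sits in which slot, \<open>code\<close> numbers the two vertices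
  of each layer, and step \<open>(c, j)\<close> is the matching from slot \<open>(c, j)\<close> to the next one, twisted if it
  belongs to \<open>T\<close>.\<close>

definition slots :: "(nat \<times> nat) set" where
  "slots = {..<2 * t} \<times> {..<k}"

definition code :: "nat \<times> nat \<Rightarrow> bool \<Rightarrow> nat" where
  "code l b = 2 * (fst l * k + snd l) + of_bool b"

definition nxt :: "nat \<times> nat \<Rightarrow> nat \<times> nat" where
  "nxt l = (fst l, Suc (snd l) mod k)"

text \<open>Only double cycles have the closing step \<open>j = k - 1\<close>.\<close>

definition steps :: "(nat \<times> nat) set" where
  "steps = {(c, j). c < 2 * t \<and> j < k \<and> (c < t \<or> Suc j < k)}"

text \<open>A strand names an edge by its step and its vertex in the layer at the start of the step.
  The names depend neither on \<open>\<phi>\<close> nor on \<open>T\<close>, so a partition can be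
  fixed as a set of strands before averaging over graphs.\<close>

definition strands :: "((nat \<times> nat) \<times> bool) set" where
  "strands = steps \<times> UNIV"

definition link :: "(nat \<times> nat \<Rightarrow> nat \<times> nat) \<Rightarrow> (nat \<times> nat) set \<Rightarrow> (nat \<times> nat) \<times> bool \<Rightarrow> edge" where
  "link \<phi> T e = {code (\<phi> (fst e)) (snd e), code (\<phi> (nxt (fst e))) (snd e \<noteq> (fst e \<in> T))}"

definition graph :: "(nat \<times> nat \<Rightarrow> nat \<times> nat) \<Rightarrow> (nat \<times> nat) set \<Rightarrow> edge set" where
  "graph \<phi> T = link \<phi> T ` strands"

definition cycle_steps :: "nat \<Rightarrow> (nat \<times> nat) set" where
  "cycle_steps c = {c} \<times> {..<k}"

lemma finite_slots: "finite slots" by (simp add: slots_def)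
lemma steps_subset_slots: "steps \<subseteq> slots" by (auto simp: steps_def slots_def)
lemma finite_steps: "finite steps" using finite_subset[OF steps_subset_slots finite_slots] .
lemma finite_strands: "finite strands" by (simp add: strands_def finite_steps)

lemma nxt_slots: "l \<in> slots \<Longrightarrow> nxt l \<in> slots" using k by (auto simp: slots_def nxt_def)

lemma code_inj:
  assumes "code l b = code l' b'" "l \<in> slots" "l' \<in> slots"
  shows "l = l'" "b = b'"
proof -
  obtain c j c' j' where l: "l = (c, j)" "l' = (c', j')" by (cases l, cases l')
  have j: "j < k" "j' < k" using assms l by (auto simp: slots_def)
  have "odd (code l b) = b" "odd (code l' b') = b'" by (auto simp: code_def)
  then have b: "b = b'" unfolding assms(1) by blast
  then show "b = b'" .
  have eq: "c * k + j = c' * k + j'" using assms(1) b l by (simp add: code_def)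
  have "c = c'" using arg_cong[OF eq, of "\<lambda>x. x div k"] j by simp
  then show "l = l'" using eq l by simp
qed

lemma code_less: "l \<in> slots \<Longrightarrow> code l b < 4 * t * k"
proof -
  assume "l \<in> slots"
  then obtain c j where l: "l = (c, j)" "c < 2 * t" "j < k" by (auto simp: slots_def)
  have "c * k + j < Suc c * k" using l by simp
  also have "\<dots> \<le> 2 * t * k" using l by (intro mult_right_mono) auto
  finally show ?thesis using l(1) by (simp add: code_def)
qed

lemma code_surj:
  assumes "v < 4 * t * k" shows "\<exists>l\<in>slots. \<exists>b. v = code l b"
proof -
  have "v div 2 < 2 * t * k" using assms by simp
  then have "v div 2 div k < 2 * t" using k by (simp add: less_mult_imp_div_less)
  then have "(v div 2 div k, v div 2 mod k) \<in> slots" using k by (auto simp: slots_def)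
  moreover have "v = code (v div 2 div k, v div 2 mod k) (odd v)"
    by (simp add: code_def)
  ultimately show ?thesis by blast
qed

text \<open>Distinct strands could share an edge only in opposite directions, which forces
  \<open>nxt (nxt l) = l\<close> and contradicts \<open>k \<ge> 3\<close>. Injectivity transports
  the uniform partition of the edges to the strands.\<close>

lemma inj_on_link:
  assumes \<phi>: "\<phi> permutes slots"
  shows "inj_on (link \<phi> T) strands"
proof (rule inj_onI)
  fix e e' assume e: "e \<in> strands" "e' \<in> strands" and eq: "link \<phi> T e = link \<phi> T e'"
  obtain l b l' b' where l: "e = (l, b)" "e' = (l', b')" by (cases e, cases e')
  have L: "l \<in> slots" "l' \<in> slots" "nxt l \<in> slots" "nxt l' \<in> slots"
    using e l steps_subset_slots by (auto simp: strands_def intro!: nxt_slots)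
  then have PL: "\<phi> l \<in> slots" "\<phi> l' \<in> slots" "\<phi> (nxt l) \<in> slots" "\<phi> (nxt l') \<in> slots"
    using permutes_in_image[OF \<phi>] by auto
  have inj: "\<phi> x = \<phi> y \<longleftrightarrow> x = y" for x y using permutes_inj[OF \<phi>] by (simp add: inj_eq)
  consider "code (\<phi> l) b = code (\<phi> l') b'"
    | "code (\<phi> l) b = code (\<phi> (nxt l')) (b' \<noteq> (l' \<in> T))" "code (\<phi> (nxt l)) (b \<noteq> (l \<in> T)) = code (\<phi> l') b'"
    using eq unfolding link_def l fst_conv snd_conv doubleton_eq_iff by argo
  then show "e = e'"
  proof cases
    case 1
    then have "\<phi> l = \<phi> l'" "b = b'" using code_inj PL by blast+
    then show ?thesis using inj l by simp
  next
    case 2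
    then have "\<phi> l = \<phi> (nxt l')" "\<phi> (nxt l) = \<phi> l'" using code_inj PL by blast+
    then have "l = nxt (nxt l)" using inj by simp
    moreover obtain c j where cj: "l = (c, j)" "j < k" using L by (cases l) (auto simp: slots_def)
    ultimately have "j = Suc (Suc j mod k) mod k" by (simp add: nxt_def)
    then have "j = (j + 2) mod k" by (simp add: mod_Suc_eq)
    then have False using cj(2) k by (cases "j + 2 < k") (auto simp: mod_if split: if_splits)
    then show ?thesis ..
  qed
qed

text \<open>The parity of the twists met in the first \<open>i\<close> steps; \<open>i mod k\<close>
  lets the walk go on around a double cycle.\<close>

primrec run :: "(nat \<times> nat) set \<Rightarrow> nat \<Rightarrow> nat \<Rightarrow> bool" where
  "run T c 0 = False"
| "run T c (Suc i) = (run T c i \<noteq> ((c, i mod k) \<in> T))"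

lemma run_eq: "i \<le> k \<Longrightarrow> run T c i = odd (card (T \<inter> {c} \<times> {..<i}))"
proof (induction i)
  case (Suc i)
  have eq: "T \<inter> {c} \<times> {..<Suc i} = (if (c, i) \<in> T then insert (c, i) (T \<inter> {c} \<times> {..<i}) else T \<inter> {c} \<times> {..<i})"
    by (auto simp: less_Suc_eq)
  have "finite (T \<inter> {c} \<times> {..<i})" by auto
  then have "card (T \<inter> {c} \<times> {..<Suc i}) = card (T \<inter> {c} \<times> {..<i}) + of_bool ((c, i) \<in> T)"
    unfolding eq by (subst if_distrib) auto
  then show ?case using Suc by auto
qed simp

text \<open>A full turn changes sides exactly if the number of twists is odd, which decides between
  one \<open>2k\<close>-cycle and two \<open>k\<close>-cycles.\<close>

lemma run_add_k: "run T c (i + k) = (run T c i \<noteq> odd (card (T \<inter> cycle_steps c)))"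
proof (induction i)
  case 0
  then show ?case using run_eq[of k T c] by (simp add: cycle_steps_def)
next
  case (Suc i)
  then show ?case by auto
qed

definition vert :: "(nat \<times> nat \<Rightarrow> nat \<times> nat) \<Rightarrow> (nat \<times> nat) set \<Rightarrow> nat \<Rightarrow> bool \<Rightarrow> nat \<Rightarrow> nat" where
  "vert \<phi> T c b i = code (\<phi> (c, i mod k)) (b \<noteq> run T c i)"

lemma vert_edge: "{vert \<phi> T c b i, vert \<phi> T c b (Suc i)} = link \<phi> T ((c, i mod k), b \<noteq> run T c i)"
proof -
  have "(b \<noteq> run T c (Suc i)) = ((b \<noteq> run T c i) \<noteq> ((c, i mod k) \<in> T))" by simp blast
  then show ?thesis unfolding vert_def link_def nxt_def fst_conv snd_conv mod_Suc_eq by (simp only:)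
qed

lemma vert_add_k: "vert \<phi> T c b (i + k) = vert \<phi> T c (b \<noteq> odd (card (T \<inter> cycle_steps c))) i"
proof -
  have "(b \<noteq> run T c (i + k)) = ((b \<noteq> odd (card (T \<inter> cycle_steps c))) \<noteq> run T c i)" unfolding run_add_k by blast
  then show ?thesis unfolding vert_def mod_add_self2 by (simp only:)
qed

text \<open>At each step the two tracks use the two strands in some order, since
  \<open>b \<mapsto> (b \<noteq> run T c i)\<close> is a bijection.\<close>

lemma double_path_edges:
  assumes "m \<le> k"
  shows "(\<Union>b. {{vert \<phi> T c b i, vert \<phi> T c b (Suc i)} | i. i < m}) = link \<phi> T ` (({c} \<times> {..<m}) \<times> UNIV)"
proof (intro set_eqI iffI)
  fix e assume "e \<in> (\<Union>b. {{vert \<phi> T c b i, vert \<phi> T c b (Suc i)} | i. i < m})"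
  then obtain b i where "i < m" "e = link \<phi> T ((c, i mod k), b \<noteq> run T c i)"
    unfolding vert_edge by auto
  then show "e \<in> link \<phi> T ` (({c} \<times> {..<m}) \<times> UNIV)" using assms by auto
next
  fix e assume "e \<in> link \<phi> T ` (({c} \<times> {..<m}) \<times> UNIV)"
  then obtain i b where "i < m" "e = link \<phi> T ((c, i), b)" by auto
  then have "e = link \<phi> T ((c, i mod k), (b \<noteq> run T c i) \<noteq> run T c i)" "i < m"
    using assms by (cases b; cases "run T c i"; simp)+
  then show "e \<in> (\<Union>b. {{vert \<phi> T c b i, vert \<phi> T c b (Suc i)} | i. i < m})"
    unfolding vert_edge by blast
qed

lemma vert_surj:
  assumes "j < k" shows "code (\<phi> (c, j)) b \<in> vert \<phi> T c (b \<noteq> run T c j) ` {..<k}"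
proof (rule image_eqI[of _ _ j])
  have "b = ((b \<noteq> run T c j) \<noteq> run T c j)" by blast
  then show "code (\<phi> (c, j)) b = vert \<phi> T c (b \<noteq> run T c j) j" using assms by (simp add: vert_def)
qed (use assms in simp)

lemma vert_less:
  assumes "\<phi> permutes slots" "c < 2 * t" shows "vert \<phi> T c b i < 4 * t * k"
proof -
  have "(c, i mod k) \<in> slots" using assms k by (auto simp: slots_def)
  then have "\<phi> (c, i mod k) \<in> slots" using permutes_in_image[OF assms(1)] by simp
  then show ?thesis unfolding vert_def by (rule code_less)
qed

definition tracks :: "(nat \<times> nat \<Rightarrow> nat \<times> nat) \<Rightarrow> (nat \<times> nat) set \<Rightarrow> nat list \<Rightarrow> nat list list" where
  "tracks \<phi> T cs = map (\<lambda>(c, b). map (vert \<phi> T c b) [0..<k]) (List.product cs [False, True])"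

lemma UN_tracks: "(\<Union>p\<in>set (tracks \<phi> T cs). f p) = (\<Union>c\<in>set cs. \<Union>b. f (map (vert \<phi> T c b) [0..<k]))"
proof -
  have bool: "set [False, True] = UNIV" by auto
  have pairs: "(\<Union>x\<in>A \<times> B. h x) = (\<Union>a\<in>A. \<Union>b\<in>B. h (a, b))" for A :: "nat set" and B :: "bool set" and h :: "nat \<times> bool \<Rightarrow> 'a set"
    by blast
  show ?thesis unfolding tracks_def set_map set_product bool image_image pairs prod.case ..
qed

lemma length_tracks: "length (tracks \<phi> T cs) = 2 * length cs" "\<forall>p\<in>set (tracks \<phi> T cs). length p = k"
  by (simp_all add: tracks_def split: prod.split)

lemma cover:
  assumes \<phi>: "\<phi> permutes slots"
  shows "(\<Union>c<2 * t. \<Union>b. vert \<phi> T c b ` {..<k}) = {..<4 * t * k}"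
proof
  show "(\<Union>c<2 * t. \<Union>b. vert \<phi> T c b ` {..<k}) \<subseteq> {..<4 * t * k}" using vert_less[OF \<phi>] by auto
  show "{..<4 * t * k} \<subseteq> (\<Union>c<2 * t. \<Union>b. vert \<phi> T c b ` {..<k})"
  proof
    fix v assume "v \<in> {..<4 * t * k}"
    then obtain l b where l: "l \<in> slots" "v = code l b" using code_surj[of v] by auto
    then obtain c j where cj: "(c, j) \<in> slots" "\<phi> (c, j) = l" using permutes_image[OF \<phi>] by force
    then show "v \<in> (\<Union>c<2 * t. \<Union>b. vert \<phi> T c b ` {..<k})"
      using vert_surj[of j \<phi> c b T] l by (auto simp: slots_def)
  qed
qed

lemma graph_eq:
  "graph \<phi> T = (\<Union>c<t. link \<phi> T ` (({c} \<times> {..<k}) \<times> UNIV)) \<union> (\<Union>c\<in>{t..<2 * t}. link \<phi> T ` (({c} \<times> {..<k - 1}) \<times> UNIV))"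
proof -
  have "strands = (\<Union>c<t. ({c} \<times> {..<k}) \<times> UNIV) \<union> (\<Union>c\<in>{t..<2 * t}. ({c} \<times> {..<k - 1}) \<times> UNIV)"
    by (auto simp: strands_def steps_def)
  then show ?thesis by (simp add: graph_def image_Un image_UN)
qed

lemma track_paths:
  "(\<Union>p\<in>set (tracks \<phi> T [t..<2 * t]). path_edges p) = (\<Union>c\<in>{t..<2 * t}. link \<phi> T ` (({c} \<times> {..<k - 1}) \<times> UNIV))"
proof -
  have "Suc i < k \<longleftrightarrow> i < k - 1" for i by auto
  then show ?thesis unfolding UN_tracks path_edges_map using double_path_edges[of "k - 1" \<phi> T] by simp
qed

lemma set_concat_tracks: "set (concat (tracks \<phi> T cs)) = (\<Union>c\<in>set cs. \<Union>b. vert \<phi> T c b ` {..<k})"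
  unfolding set_concat UN_tracks by (simp add: lessThan_atLeast0)

lemma split_cover:
  assumes "\<phi> permutes slots"
  shows "(\<Union>c<t. \<Union>b. vert \<phi> T c b ` {..<k}) \<union> (\<Union>c\<in>{t..<2 * t}. \<Union>b. vert \<phi> T c b ` {..<k}) = {..<4 * t * k}"
proof -
  have *: "{..<2 * t} = {..<t} \<union> {t..<2 * t}" by auto
  show ?thesis using cover[OF assms, of T] unfolding * UN_Un .
qed

lemma graph_even:
  assumes \<phi>: "\<phi> permutes slots" and ev: "\<And>c. c < t \<Longrightarrow> even (card (T \<inter> cycle_steps c))"
  shows "disjoint_cycles_paths (4 * t * k) (2 * t) k (2 * t) (k - 1) (graph \<phi> T)"
proof (rule disjoint_cycles_pathsI[where cs = "tracks \<phi> T [0..<t]" and ps = "tracks \<phi> T [t..<2 * t]"])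
  show "set (concat (tracks \<phi> T [0..<t] @ tracks \<phi> T [t..<2 * t])) = {..<4 * t * k}"
    unfolding concat_append set_append set_concat_tracks using split_cover[OF \<phi>, of T]
    by (simp add: lessThan_atLeast0)
  have cycle_steps: "(\<Union>b. cycle_edges (map (vert \<phi> T c b) [0..<k])) = link \<phi> T ` (({c} \<times> {..<k}) \<times> UNIV)" if "c < t" for c
  proof -
    have "vert \<phi> T c b k = vert \<phi> T c b 0" for b using vert_add_k[of \<phi> T c b 0] ev[OF that] by simp
    then have "(\<Union>b. cycle_edges (map (vert \<phi> T c b) [0..<k])) = (\<Union>b. {{vert \<phi> T c b i, vert \<phi> T c b (Suc i)} | i. i < k})"
      by (simp add: cycle_edges_map)
    then show ?thesis using double_path_edges[of k \<phi> T c] by simp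
  qed
  show "graph \<phi> T = (\<Union>c\<in>set (tracks \<phi> T [0..<t]). cycle_edges c) \<union> (\<Union>p\<in>set (tracks \<phi> T [t..<2 * t]). path_edges p)"
    unfolding track_paths unfolding UN_tracks graph_eq set_upt atLeast0LessThan
    by (intro arg_cong2[where f = "(\<union>)"] SUP_cong refl cycle_steps[symmetric]) (rule lessThan_iff[THEN iffD1])
  show "2 * t * k + 2 * t * (k - 1 + 1) = 4 * t * k" using k by simp
qed (use k in \<open>simp_all add: length_tracks\<close>)

text \<open>After \<open>k\<close> steps the track \<open>False\<close> goes on as the track
  \<open>True\<close>, and after \<open>2 * k\<close> steps it closes up; so the track
  \<open>False\<close> alone lists the whole cycle.\<close>

lemma graph_odd:
  assumes \<phi>: "\<phi> permutes slots" and od: "\<And>c. c < t \<Longrightarrow> odd (card (T \<inter> cycle_steps c))"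
  shows "disjoint_cycles_paths (4 * t * k) t (2 * k) (2 * t) (k - 1) (graph \<phi> T)"
proof (rule disjoint_cycles_pathsI[where cs = "map (\<lambda>c. map (vert \<phi> T c False) [0..<2 * k]) [0..<t]" and ps = "tracks \<phi> T [t..<2 * t]"])
  have lt: "{..<2 * k} = {..<k} \<union> (\<lambda>i. i + k) ` {..<k}"
  proof -
    have "i \<in> (\<lambda>i. i + k) ` {..<k}" if "i < 2 * k" "\<not> i < k" for i
      using that by (intro image_eqI[of _ _ "i - k"]) auto
    then show ?thesis by auto
  qed
  have UNb: "(\<Union>b. f b) = f False \<union> f True" for f :: "bool \<Rightarrow> 'b set" by (auto simp: UNIV_bool)
  have shift: "vert \<phi> T c False (i + k) = vert \<phi> T c True i" if "c < t" for c i
    using vert_add_k[of \<phi> T c False i] od[OF that] by simp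
  have "vert \<phi> T c False ` {..<2 * k} = (\<Union>b. vert \<phi> T c b ` {..<k})" if "c < t" for c
    unfolding lt image_Un image_image shift[OF that] UNb ..
  then show "set (concat (map (\<lambda>c. map (vert \<phi> T c False) [0..<2 * k]) [0..<t] @ tracks \<phi> T [t..<2 * t])) = {..<4 * t * k}"
    unfolding concat_append set_append set_concat_tracks using split_cover[OF \<phi>, of T]
    by (simp add: lessThan_atLeast0)
  have "cycle_edges (map (vert \<phi> T c False) [0..<2 * k]) = link \<phi> T ` (({c} \<times> {..<k}) \<times> UNIV)" if c: "c < t" for c
  proof -
    have "vert \<phi> T c False (2 * k) = vert \<phi> T c False 0"
      using shift[OF c, of k] vert_add_k[of \<phi> T c True 0] od[OF c] by (simp add: mult_2)
    then have "cycle_edges (map (vert \<phi> T c False) [0..<2 * k])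
        = (\<lambda>i. {vert \<phi> T c False i, vert \<phi> T c False (Suc i)}) ` {..<2 * k}"
      by (subst cycle_edges_map) auto
    also have "\<dots> = (\<Union>b. (\<lambda>i. {vert \<phi> T c b i, vert \<phi> T c b (Suc i)}) ` {..<k})"
      unfolding lt image_Un image_image add_Suc[symmetric] shift[OF c] UNb ..
    also have "\<dots> = (\<Union>b. {{vert \<phi> T c b i, vert \<phi> T c b (Suc i)} | i. i < k})" by auto
    finally show ?thesis using double_path_edges[of k \<phi> T c] by simp
  qed
  then show "graph \<phi> T = (\<Union>c\<in>set (map (\<lambda>c. map (vert \<phi> T c False) [0..<2 * k]) [0..<t]). cycle_edges c)
      \<union> (\<Union>p\<in>set (tracks \<phi> T [t..<2 * t]). path_edges p)"
    unfolding track_paths graph_eq by (simp add: lessThan_atLeast0)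
  show "t * (2 * k) + 2 * t * (k - 1 + 1) = 4 * t * k" using k by simp
qed (use k in \<open>simp_all add: length_tracks\<close>)

lemma NGC_graph:
  assumes \<phi>: "\<phi> permutes slots"
  shows "(\<And>c. c < t \<Longrightarrow> odd (card (T \<inter> cycle_steps c))) \<Longrightarrow> (graph \<phi> T, True) \<in> NGC (4 * t * k) k"
    and "(\<And>c. c < t \<Longrightarrow> even (card (T \<inter> cycle_steps c))) \<Longrightarrow> (graph \<phi> T, False) \<in> NGC (4 * t * k) k"
proof -
  have "4 * t * k div (4 * k) = t" "4 * t * k div (2 * k) = 2 * t" using k by (simp_all add: mult.assoc div_mult_mult1)
  then show "(\<And>c. c < t \<Longrightarrow> odd (card (T \<inter> cycle_steps c))) \<Longrightarrow> (graph \<phi> T, True) \<in> NGC (4 * t * k) k"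
    and "(\<And>c. c < t \<Longrightarrow> even (card (T \<inter> cycle_steps c))) \<Longrightarrow> (graph \<phi> T, False) \<in> NGC (4 * t * k) k"
    using graph_odd[OF \<phi>, of T] graph_even[OF \<phi>, of T] by (auto simp: NGC_def)
qed

end

subsection \<open>Hiding gadgets from Alice\<close>

lemma sum_Pow_Un_image:
  fixes f :: "'a set \<Rightarrow> real"
  assumes A: "finite A" "A \<inter> p ` X = {}" and X: "finite X" "inj_on p X"
  shows "(\<Sum>T\<in>Pow (A \<union> p ` X). f T) = (\<Sum>Z\<in>Pow A. \<Sum>y\<in>Pow X. f (Z \<union> p ` y))"
proof -
  have "bij_betw (\<lambda>(Z, y). Z \<union> p ` y) (Pow A \<times> Pow X) (Pow (A \<union> p ` X))"
  proof (rule bij_betwI[where g = "\<lambda>T. (T \<inter> A, {x \<in> X. p x \<in> T})"])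
    show "(\<lambda>T. (T \<inter> A, {x \<in> X. p x \<in> T})) \<in> Pow (A \<union> p ` X) \<rightarrow> Pow A \<times> Pow X" by auto
    show "(\<lambda>(Z, y). Z \<union> p ` y) \<in> Pow A \<times> Pow X \<rightarrow> Pow (A \<union> p ` X)" by auto
    fix T assume "T \<in> Pow (A \<union> p ` X)"
    then show "(case (T \<inter> A, {x \<in> X. p x \<in> T}) of (Z, y) \<Rightarrow> Z \<union> p ` y) = T" by auto
  next
    fix Zy assume "Zy \<in> Pow A \<times> Pow X"
    then obtain Z y where Zy: "Zy = (Z, y)" "Z \<subseteq> A" "y \<subseteq> X" by auto
    have "(Z \<union> p ` y) \<inter> A = Z" using Zy A(2) by blast
    moreover have "{x \<in> X. p x \<in> Z \<union> p ` y} = y"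
    proof
      show "{x \<in> X. p x \<in> Z \<union> p ` y} \<subseteq> y"
      proof
        fix x assume x: "x \<in> {x \<in> X. p x \<in> Z \<union> p ` y}"
        then have "p x \<in> p ` y" using Zy A(2) by blast
        then show "x \<in> y" using x Zy X(2) by (auto dest: inj_onD)
      qed
    qed (use Zy in auto)
    ultimately show "((case Zy of (Z, y) \<Rightarrow> Z \<union> p ` y) \<inter> A, {x \<in> X. p x \<in> (case Zy of (Z, y) \<Rightarrow> Z \<union> p ` y)}) = Zy"
      using Zy by simp
  qed
  from sum.reindex_bij_betw[OF this, of f, symmetric] show ?thesis
    by (simp add: sum.cartesian_product split_def)
qed

text \<open>Fresh uniform bits on the image of \<open>X\<close> leave the distribution of a uniform
  \<open>T\<close> unchanged.\<close>

lemma sum_resample: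
  fixes H :: "'a set \<Rightarrow> real"
  assumes A: "finite A" "p ` X \<subseteq> A" and X: "finite X" "inj_on p X"
  shows "(\<Sum>T\<in>Pow A. mean X (\<lambda>y. H ((T - p ` X) \<union> p ` y))) = (\<Sum>T\<in>Pow A. H T)"
proof -
  define B where "B = A - p ` X"
  have B: "finite B" "B \<inter> p ` X = {}" and A': "A = B \<union> p ` X" using A by (auto simp: B_def)
  note split = sum_Pow_Un_image[OF B X]
  have "(Z \<union> p ` y) - p ` X = Z" if "Z \<in> Pow B" "y \<in> Pow X" for Z y using that B(2) by blast
  then have "(\<Sum>T\<in>Pow A. mean X (\<lambda>y. H ((T - p ` X) \<union> p ` y)))
      = (\<Sum>Z\<in>Pow B. \<Sum>y\<in>Pow X. mean X (\<lambda>y. H (Z \<union> p ` y)))"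
    unfolding A' split by (intro sum.cong refl) simp
  also have "\<dots> = (\<Sum>Z\<in>Pow B. \<Sum>y\<in>Pow X. H (Z \<union> p ` y))"
    using X by (simp add: mean_def card_Pow)
  finally show ?thesis unfolding A' split .
qed

lemma mean_Un:
  assumes "finite A" "finite B" "A \<inter> B = {}"
  shows "mean (A \<union> B) (\<lambda>a. f (a \<inter> A) * g (a \<inter> B)) = mean A f * mean B g"
proof -
  have "(\<Sum>a\<in>Pow (A \<union> B). f (a \<inter> A) * g (a \<inter> B))
     = (\<Sum>Z\<in>Pow A. \<Sum>y\<in>Pow B. f ((Z \<union> y) \<inter> A) * g ((Z \<union> y) \<inter> B))"
    using sum_Pow_Un_image[of A id B "\<lambda>a. f (a \<inter> A) * g (a \<inter> B)"] assms by simp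
  also have "\<dots> = (\<Sum>Z\<in>Pow A. \<Sum>y\<in>Pow B. f Z * g y)"
  proof (intro sum.cong refl)
    fix Z y assume "Z \<in> Pow A" "y \<in> Pow B"
    then have "(Z \<union> y) \<inter> A = Z" "(Z \<union> y) \<inter> B = y" using assms(3) by blast+
    then show "f ((Z \<union> y) \<inter> A) * g ((Z \<union> y) \<inter> B) = f Z * g y" by simp
  qed
  finally show ?thesis using assms by (simp add: mean_def sum_product card_Un_disjoint power_add)
qed

text \<open>Independence of the traces of a uniform set on disjoint blocks.\<close>

lemma mean_prod:
  assumes "finite I" "finite X" "\<And>i. i \<in> I \<Longrightarrow> Y i \<subseteq> X" "disjoint_family_on Y I"
  shows "mean X (\<lambda>a. \<Prod>i\<in>I. q i (a \<inter> Y i)) = (\<Prod>i\<in>I. mean (Y i) (q i))"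
  using assms
proof (induction I arbitrary: X rule: finite_induct)
  case empty
  then show ?case by (simp add: mean_const)
next
  case (insert i I)
  define B where "B = X - Y i"
  have Y: "finite (Y i)" "finite B" "B \<inter> Y i = {}" "X = B \<union> Y i"
    using insert.prems by (auto simp: B_def intro: finite_subset)
  have YB: "Y j \<subseteq> B" if "j \<in> I" for j
    using that insert by (auto simp: B_def disjoint_family_on_def)
  have "mean X (\<lambda>a. \<Prod>j\<in>insert i I. q j (a \<inter> Y j))
      = mean (B \<union> Y i) (\<lambda>a. (\<lambda>b. \<Prod>j\<in>I. q j (b \<inter> Y j)) (a \<inter> B) * q i (a \<inter> Y i))"
    unfolding Y(4)
  proof (rule mean_cong)
    fix a assume "a \<subseteq> B \<union> Y i"
    have "a \<inter> B \<inter> Y j = a \<inter> Y j" if "j \<in> I" for j using YB[OF that] by blast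
    then show "(\<Prod>j\<in>insert i I. q j (a \<inter> Y j)) = (\<Prod>j\<in>I. q j (a \<inter> B \<inter> Y j)) * q i (a \<inter> Y i)"
      using insert.hyps by simp
  qed
  also have "\<dots> = mean B (\<lambda>b. \<Prod>j\<in>I. q j (b \<inter> Y j)) * mean (Y i) (q i)"
    using Y by (intro mean_Un) auto
  also have "mean B (\<lambda>b. \<Prod>j\<in>I. q j (b \<inter> Y j)) = (\<Prod>j\<in>I. mean (Y j) (q j))"
    using Y YB insert.prems by (intro insert.IH) (auto simp: disjoint_family_on_def)
  finally show ?case using insert.hyps by simp
qed

section \<open>Good windows and the relocation of their middle layers\<close>

context layers
begin

text \<open>Window \<open>i\<close> consists of the steps \<open>3 * i\<close> to
  \<open>3 * i + 2\<close>. The \<open>k - 1\<close> guarantees \<open>3 * i + 3 < k\<close>, so no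
  window meets the closing step, and cycles and paths have equally many windows.\<close>

definition nwin :: nat where "nwin = (k - 1) div 3"
definition windows :: "(nat \<times> nat) set" where "windows = {..<2 * t} \<times> {..<nwin}"
text \<open>\<open>left\<close>, \<open>mid\<close> and \<open>right\<close> name steps and slots
  alike: step \<open>mid g\<close> joins the layers in the slots \<open>mid g\<close> and
  \<open>right g\<close>.\<close>

definition left :: "nat \<times> nat \<Rightarrow> nat \<times> nat" where "left g = (fst g, 3 * snd g)"
definition mid :: "nat \<times> nat \<Rightarrow> nat \<times> nat" where "mid g = (fst g, 3 * snd g + 1)"
definition right :: "nat \<times> nat \<Rightarrow> nat \<times> nat" where "right g = (fst g, 3 * snd g + 2)"

definition window :: "nat \<times> nat \<Rightarrow> ((nat \<times> nat) \<times> bool) set" where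
  "window g = {left g, mid g, right g} \<times> UNIV"

definition good :: "((nat \<times> nat) \<times> bool) set \<Rightarrow> (nat \<times> nat) set" where
  "good a = {g \<in> windows. a \<inter> window g = {mid g} \<times> UNIV}"

text \<open>Slots with index divisible by 3 stay fixed; the other two slots of a window move
  together, which keeps the matching between them inside the pair.\<close>

definition lift :: "(nat \<times> nat \<Rightarrow> nat \<times> nat) \<Rightarrow> nat \<times> nat \<Rightarrow> nat \<times> nat" where
  "lift \<sigma> l = (if snd l mod 3 = 0 then l
     else (fst (\<sigma> (fst l, snd l div 3)), 3 * snd (\<sigma> (fst l, snd l div 3)) + snd l mod 3))"

text \<open>The permutation \<open>\<sigma>\<close> moves the pair of layers joined by the middle matching of a window; the set \<open>x\<close>
  records the twists by these pairs, hence the twist found in window \<open>g\<close> is that of \<open>\<sigma> g\<close>.\<close>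

definition retwist :: "(nat \<times> nat) set \<Rightarrow> (nat \<times> nat) set \<Rightarrow> (nat \<times> nat \<Rightarrow> nat \<times> nat) \<Rightarrow>
    (nat \<times> nat) set \<Rightarrow> (nat \<times> nat) set \<Rightarrow> (nat \<times> nat) set" where
  "retwist T \<Gamma> \<sigma> x r = (T - left ` \<Gamma> \<union> left ` r) - mid ` \<Gamma> \<union> mid ` {g \<in> \<Gamma>. \<sigma> g \<in> x}"

lemma windows_less: "(c, i) \<in> windows \<Longrightarrow> c < 2 * t \<and> 3 * i + 3 < k"
  by (auto simp: windows_def nwin_def)

lemma finite_windows: "finite windows" by (simp add: windows_def)

lemma mid_eq_iff: "mid g = mid g' \<longleftrightarrow> g = g'" "left g = left g' \<longleftrightarrow> g = g'" "right g = right g' \<longleftrightarrow> g = g'"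
  by (auto simp: mid_def left_def right_def prod_eq_iff)

lemma window_neq: "mid g \<noteq> left g'" "left g \<noteq> mid g'" "mid g \<noteq> right g'" "right g \<noteq> mid g'" "left g \<noteq> right g'" "right g \<noteq> left g'"
proof -
  have "3 * i + 1 \<noteq> 3 * j" "3 * i + 2 \<noteq> 3 * j" "3 * i + 1 \<noteq> 3 * j + 2" for i j :: nat by presburger+
  note this this[symmetric]
  then show "mid g \<noteq> left g'" "left g \<noteq> mid g'" "mid g \<noteq> right g'" "right g \<noteq> mid g'" "left g \<noteq> right g'" "right g \<noteq> left g'"
    unfolding mid_def left_def right_def prod.inject by blast+
qed

lemma window_steps: "g \<in> windows \<Longrightarrow> left g \<in> steps \<and> mid g \<in> steps \<and> right g \<in> steps"
  using windows_less[of "fst g" "snd g"] by (auto simp: steps_def left_def mid_def right_def)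

lemma nxt_mid: "g \<in> windows \<Longrightarrow> nxt (mid g) = right g"
  using windows_less[of "fst g" "snd g"] by (auto simp: nxt_def mid_def right_def)

lemma lift_mid: "lift \<sigma> (mid g) = mid (\<sigma> g)" "lift \<sigma> (right g) = right (\<sigma> g)"
proof -
  have "(3 * i + 1) div 3 = i" "(3 * i + 2) div 3 = i" "(3 * i + 1) mod 3 = 1" "(3 * i + 2) mod 3 = 2" for i :: nat
    by presburger+
  then show "lift \<sigma> (mid g) = mid (\<sigma> g)" "lift \<sigma> (right g) = right (\<sigma> g)"
    by (simp_all add: lift_def mid_def right_def)
qed

lemma lift_cases: "lift \<sigma> l = l \<or> (\<exists>g. (l = mid g \<or> l = right g) \<and> \<sigma> g \<noteq> g)"
proof (cases "snd l mod 3 = 0 \<or> \<sigma> (fst l, snd l div 3) = (fst l, snd l div 3)")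
  case True
  then show ?thesis by (auto simp: lift_def prod_eq_iff)
next
  case False
  define g where "g = (fst l, snd l div 3)"
  have "j = 3 * (j div 3) + 1 \<or> j = 3 * (j div 3) + 2" if "j mod 3 \<noteq> 0" for j :: nat using that by presburger
  then have "snd l = 3 * (snd l div 3) + 1 \<or> snd l = 3 * (snd l div 3) + 2" using False by blast
  then have "l = mid g \<or> l = right g" by (auto simp: mid_def right_def g_def prod_eq_iff)
  then show ?thesis using False by (auto simp: g_def)
qed

lemma lift_comp: "lift \<sigma> (lift \<tau> l) = lift (\<sigma> \<circ> \<tau>) l"
  by (simp add: lift_def)

lemma lift_id: "lift id l = l"
  by (simp add: lift_def prod_eq_iff)

lemma lift_permutes:
  assumes \<sigma>: "\<sigma> permutes \<Gamma>" and \<Gamma>: "\<Gamma> \<subseteq> windows"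
  shows "lift \<sigma> permutes slots"
proof (rule bij_imp_permutes)
  have "lift (inv \<sigma>) \<circ> lift \<sigma> = id" "lift \<sigma> \<circ> lift (inv \<sigma>) = id"
    by (auto simp: lift_comp permutes_inv_o[OF \<sigma>] lift_id)
  then have bij: "bij (lift \<sigma>)" by (rule o_bij)
  show outside: "lift \<sigma> l = l" if "l \<notin> slots" for l
  proof (rule ccontr)
    assume "lift \<sigma> l \<noteq> l"
    then obtain g where g: "l = mid g \<or> l = right g" "\<sigma> g \<noteq> g" using lift_cases[of \<sigma> l] by blast
    then have "g \<in> windows" using permutes_not_in[OF \<sigma>] \<Gamma> by blast
    then have "l \<in> slots" using g window_steps[of g] steps_subset_slots by auto
    with that show False by simp
  qed
  show "bij_betw (lift \<sigma>) slots slots"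
    unfolding bij_betw_def
  proof
    show "inj_on (lift \<sigma>) slots" using bij by (meson bij_is_inj inj_on_subset subset_UNIV)
    show "lift \<sigma> ` slots = slots"
    proof (rule card_subset_eq[OF finite_slots])
      show "lift \<sigma> ` slots \<subseteq> slots"
      proof
        fix y assume "y \<in> lift \<sigma> ` slots"
        then obtain l where l: "l \<in> slots" "y = lift \<sigma> l" by auto
        show "y \<in> slots"
        proof (rule ccontr)
          assume "y \<notin> slots"
          then have "lift \<sigma> y = lift \<sigma> l" using outside l by simp
          then have "y = l" using bij by (meson bij_is_inj injD)
          then show False using l \<open>y \<notin> slots\<close> by simp
        qed
      qed
      show "card (lift \<sigma> ` slots) = card slots" using bij by (meson bij_is_inj card_image inj_on_subset subset_UNIV)
    qed
  qed
qed

lemma goodD: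
  assumes "g \<in> good a"
  shows "g \<in> windows" "(mid g, b) \<in> a" "(left g, b) \<notin> a" "(right g, b) \<notin> a"
proof -
  have eq: "a \<inter> window g = {mid g} \<times> UNIV" using assms by (simp add: good_def)
  show "g \<in> windows" using assms by (simp add: good_def)
  have "(mid g, b) \<in> a \<inter> window g" unfolding eq by simp
  then show "(mid g, b) \<in> a" by simp
  show "(left g, b) \<notin> a"
  proof
    assume "(left g, b) \<in> a"
    then have "(left g, b) \<in> a \<inter> window g" by (simp add: window_def)
    then show False unfolding eq using window_neq by simp
  qed
  show "(right g, b) \<notin> a"
  proof
    assume "(right g, b) \<in> a"
    then have "(right g, b) \<in> a \<inter> window g" by (simp add: window_def)
    then show False unfolding eq using window_neq by simp
  qed
qed

lemma retwist_mid:
  assumes "g \<in> \<Gamma>" "r \<subseteq> \<Gamma>" shows "mid g \<in> retwist T \<Gamma> \<sigma> x r \<longleftrightarrow> \<sigma> g \<in> x"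
  using assms by (auto simp: retwist_def mid_eq_iff window_neq)

lemma retwist_other:
  assumes "l \<notin> mid ` \<Gamma>" "l \<notin> left ` \<Gamma>" "r \<subseteq> \<Gamma>" shows "l \<in> retwist T \<Gamma> \<sigma> x r \<longleftrightarrow> l \<in> T"
  using assms by (auto simp: retwist_def)

text \<open>Only the set of Alice's edges is preserved, not the edge of each strand: the middle
  strands of window \<open>g\<close> take over the edges of window \<open>\<sigma> g\<close>. Her
  other strands meet no moved slot and no changed twist, because the remaining steps at the moved
  slots are the outer ones of the window, which Bob holds. For fixed \<open>a\<close>,
  \<open>\<phi>\<close> and \<open>T\<close>, her message thus depends on \<open>x\<close>
  alone.\<close>

lemma alice_edges:
  assumes \<Gamma>: "\<Gamma> \<subseteq> good a" and \<sigma>: "\<sigma> permutes \<Gamma>" and r: "r \<subseteq> \<Gamma>" and a: "a \<subseteq> strands"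
  shows "link (\<phi> \<circ> lift \<sigma>) (retwist T \<Gamma> \<sigma> x r) ` a = link \<phi> (retwist T \<Gamma> id x {}) ` a"
proof -
  define a' where "a' = {e \<in> a. fst e \<notin> mid ` \<Gamma>}"
  have split: "a = a' \<union> (mid ` \<Gamma>) \<times> UNIV" using \<Gamma> goodD(2) by (auto simp: a'_def)
  have "link (\<phi> \<circ> lift \<sigma>) (retwist T \<Gamma> \<sigma> x r) e = link \<phi> (retwist T \<Gamma> id x {}) e" if e: "e \<in> a'" for e
  proof -
    obtain l b where lb: "e = (l, b)" by (cases e)
    have la: "(l, b) \<in> a" "l \<notin> mid ` \<Gamma>" "l \<in> steps" using e lb a by (auto simp: a'_def strands_def)
    have ll: "l \<notin> left ` \<Gamma>" "l \<notin> right ` \<Gamma>" using la(1) \<Gamma> goodD(3,4) by blast+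
    have fixed: "\<sigma> g \<noteq> g \<Longrightarrow> g \<in> \<Gamma>" for g using permutes_not_in[OF \<sigma>] by blast
    have 1: "lift \<sigma> l = l" using lift_cases[of \<sigma> l] fixed la(2) ll by blast
    have 2: "lift \<sigma> (nxt l) = nxt l"
    proof (rule ccontr)
      assume "lift \<sigma> (nxt l) \<noteq> nxt l"
      then obtain g where g: "nxt l = mid g \<or> nxt l = right g" "g \<in> \<Gamma>" using lift_cases[of \<sigma> "nxt l"] fixed by blast
      obtain c j where cj: "l = (c, j)" "j < k" using la(3) by (cases l) (auto simp: steps_def)
      \<comment> \<open>Index 0 is not the index of any \<open>mid g\<close> or
        \<open>right g\<close>, so the step \<open>l\<close> does not wrap around.\<close>
      have "Suc j mod k \<noteq> 0" using g cj by (auto simp: nxt_def mid_def right_def)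
      then have "Suc j mod k = Suc j" using cj by (metis Suc_lessI mod_less mod_self)
      then have "l = left g \<or> l = mid g" using g cj by (auto simp: nxt_def mid_def right_def left_def prod_eq_iff)
      then show False using g la(2) ll by blast
    qed
    have 3: "l \<in> retwist T \<Gamma> \<sigma> x r \<longleftrightarrow> l \<in> retwist T \<Gamma> id x {}"
      using retwist_other[OF la(2) ll(1)] r by simp
    show ?thesis using 1 2 3 by (simp add: link_def lb)
  qed
  then have A: "link (\<phi> \<circ> lift \<sigma>) (retwist T \<Gamma> \<sigma> x r) ` a' = link \<phi> (retwist T \<Gamma> id x {}) ` a'"
    by (intro image_cong) auto
  have M: "link (\<phi> \<circ> lift \<sigma>) (retwist T \<Gamma> \<sigma> x r) (mid g, b) = link \<phi> (retwist T \<Gamma> id x {}) (mid (\<sigma> g), b)"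
    if g: "g \<in> \<Gamma>" for g b
  proof -
    have sg: "\<sigma> g \<in> \<Gamma>" using \<sigma> g permutes_in_image by metis
    have W: "g \<in> windows" "\<sigma> g \<in> windows" using g sg \<Gamma> goodD(1) by blast+
    show ?thesis
      using retwist_mid[OF g r, of T \<sigma> x] retwist_mid[OF sg, of "{}" T id x] W
      by (simp add: link_def nxt_mid lift_mid)
  qed
  have im: "f ` (mid ` A \<times> UNIV) = (\<Union>g\<in>A. \<Union>b. {f (mid g, b)})" for A and f :: "(nat \<times> nat) \<times> bool \<Rightarrow> edge"
    by blast
  have "link (\<phi> \<circ> lift \<sigma>) (retwist T \<Gamma> \<sigma> x r) ` (mid ` \<Gamma> \<times> UNIV)
      = (\<Union>g\<in>\<sigma> ` \<Gamma>. \<Union>b. {link \<phi> (retwist T \<Gamma> id x {}) (mid g, b)})"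
    unfolding im image_image by (intro SUP_cong refl) (simp add: M)
  also have "\<dots> = link \<phi> (retwist T \<Gamma> id x {}) ` (mid ` \<Gamma> \<times> UNIV)"
    unfolding permutes_image[OF \<sigma>] im ..
  finally have "link (\<phi> \<circ> lift \<sigma>) (retwist T \<Gamma> \<sigma> x r) ` (mid ` \<Gamma> \<times> UNIV) = link \<phi> (retwist T \<Gamma> id x {}) ` (mid ` \<Gamma> \<times> UNIV)" .
  then show ?thesis using A unfolding split image_Un by (simp only:)
qed

text \<open>The bits \<open>x\<close> enter only the twists of middle steps, whose strands Alice
  holds.\<close>

lemma bob_edges:
  assumes \<Gamma>: "\<Gamma> \<subseteq> good a"
  shows "link \<phi> (retwist T \<Gamma> \<sigma> x r) ` (strands - a) = link \<phi> (retwist T \<Gamma> \<sigma> {} r) ` (strands - a)"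
proof (intro image_cong refl)
  fix e assume e: "e \<in> strands - a"
  then have "fst e \<notin> mid ` \<Gamma>" using \<Gamma> goodD(2) by (cases e) auto
  then have "fst e \<in> retwist T \<Gamma> \<sigma> x r \<longleftrightarrow> fst e \<in> retwist T \<Gamma> \<sigma> {} r" by (auto simp: retwist_def)
  then show "link \<phi> (retwist T \<Gamma> \<sigma> x r) e = link \<phi> (retwist T \<Gamma> \<sigma> {} r) e" by (simp add: link_def)
qed

text \<open>The twists of a component split disjointly into untouched ones, masks and middle ones.
  The result has the form \<open>\<kappa> c * walsh (G c) r * ...\<close> demanded by
  \<open>hidden_parity_advantage_le\<close>.\<close>

lemma walsh_retwist:
  assumes \<Gamma>: "\<Gamma> \<subseteq> windows" and \<sigma>: "\<sigma> permutes \<Gamma>" and xr: "x \<subseteq> \<Gamma>" "r \<subseteq> \<Gamma>"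
  shows "walsh (cycle_steps c) (retwist T \<Gamma> \<sigma> x r) = walsh (cycle_steps c) (T - left ` \<Gamma> - mid ` \<Gamma>)
     * walsh {g \<in> \<Gamma>. fst g = c} r * walsh (\<sigma> ` {g \<in> \<Gamma>. fst g = c}) x"
proof -
  have fin: "finite \<Gamma>" using finite_subset[OF \<Gamma> finite_windows] .
  have finc: "finite (cycle_steps c)" by (simp add: cycle_steps_def)
  have W: "3 * snd g + 3 < k" if "g \<in> \<Gamma>" for g using that \<Gamma> windows_less[of "fst g" "snd g"] by auto
  have lc: "left g \<in> cycle_steps c \<longleftrightarrow> fst g = c" "mid g \<in> cycle_steps c \<longleftrightarrow> fst g = c" if "g \<in> \<Gamma>" for g
    using W[OF that] by (auto simp: cycle_steps_def left_def mid_def)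
  have eq: "cycle_steps c \<inter> retwist T \<Gamma> \<sigma> x r = (cycle_steps c \<inter> (T - left ` \<Gamma> - mid ` \<Gamma>))
      \<union> (left ` ({g \<in> \<Gamma>. fst g = c} \<inter> r) \<union> mid ` {g \<in> \<Gamma>. fst g = c \<and> \<sigma> g \<in> x})"
  proof (intro set_eqI)
    fix l
    have L: "l \<in> cycle_steps c \<and> l \<in> left ` r \<longleftrightarrow> l \<in> left ` ({g \<in> \<Gamma>. fst g = c} \<inter> r)"
      using xr lc by blast
    have M: "l \<in> cycle_steps c \<and> l \<in> mid ` {g \<in> \<Gamma>. \<sigma> g \<in> x} \<longleftrightarrow> l \<in> mid ` {g \<in> \<Gamma>. fst g = c \<and> \<sigma> g \<in> x}"
      using lc by blast
    have N: "l \<in> left ` r \<Longrightarrow> l \<notin> mid ` \<Gamma>" using window_neq by auto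
    show "l \<in> cycle_steps c \<inter> retwist T \<Gamma> \<sigma> x r \<longleftrightarrow> l \<in> (cycle_steps c \<inter> (T - left ` \<Gamma> - mid ` \<Gamma>))
      \<union> (left ` ({g \<in> \<Gamma>. fst g = c} \<inter> r) \<union> mid ` {g \<in> \<Gamma>. fst g = c \<and> \<sigma> g \<in> x})"
      unfolding Un_iff L[symmetric] M[symmetric] retwist_def Int_iff Diff_iff using N by blast
  qed
  have "card (cycle_steps c \<inter> retwist T \<Gamma> \<sigma> x r) = card (cycle_steps c \<inter> (T - left ` \<Gamma> - mid ` \<Gamma>))
     + (card (left ` ({g \<in> \<Gamma>. fst g = c} \<inter> r)) + card (mid ` {g \<in> \<Gamma>. fst g = c \<and> \<sigma> g \<in> x}))"
    unfolding eq
    using fin finc window_neq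
    by (subst card_Un_disjoint, simp, simp, blast, subst card_Un_disjoint) auto
  also have "card (left ` ({g \<in> \<Gamma>. fst g = c} \<inter> r)) = card ({g \<in> \<Gamma>. fst g = c} \<inter> r)"
    by (intro card_image) (auto simp: inj_on_def mid_eq_iff)
  also have "card (mid ` {g \<in> \<Gamma>. fst g = c \<and> \<sigma> g \<in> x}) = card {g \<in> \<Gamma>. fst g = c \<and> \<sigma> g \<in> x}"
    by (intro card_image) (auto simp: inj_on_def mid_eq_iff)
  also have "card {g \<in> \<Gamma>. fst g = c \<and> \<sigma> g \<in> x} = card (\<sigma> ` {g \<in> \<Gamma>. fst g = c \<and> \<sigma> g \<in> x})"
    using permutes_inj[OF \<sigma>] by (intro card_image[symmetric]) (auto simp: inj_on_def)
  also have "\<sigma> ` {g \<in> \<Gamma>. fst g = c \<and> \<sigma> g \<in> x} = \<sigma> ` {g \<in> \<Gamma>. fst g = c} \<inter> x" by auto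
  finally show ?thesis by (simp add: walsh_def power_add)
qed

text \<open>Planting is invisible on average:
  \<open>\<phi> \<mapsto> \<phi> \<circ> lift \<sigma>\<close> permutes the arrangements, while
  \<open>r\<close> and \<open>x\<close> merely resample uniform twists.\<close>

lemma sum_retwist:
  fixes F :: "(nat \<times> nat \<Rightarrow> nat \<times> nat) \<Rightarrow> (nat \<times> nat) set \<Rightarrow> real"
  assumes \<Gamma>: "\<Gamma> \<subseteq> windows" and \<sigma>: "\<sigma> permutes \<Gamma>"
  shows "(\<Sum>\<phi> | \<phi> permutes slots. \<Sum>T\<in>Pow steps. mean \<Gamma> (\<lambda>r. mean \<Gamma> (\<lambda>x. F (\<phi> \<circ> lift \<sigma>) (retwist T \<Gamma> \<sigma> x r))))
    = (\<Sum>\<phi> | \<phi> permutes slots. \<Sum>T\<in>Pow steps. F \<phi> T)"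
proof -
  have fin: "finite \<Gamma>" using finite_subset[OF \<Gamma> finite_windows] .
  have LM: "left ` \<Gamma> \<subseteq> steps" "mid ` \<Gamma> \<subseteq> steps" using \<Gamma> window_steps by auto
  have inj: "inj_on left \<Gamma>" "inj_on mid \<Gamma>" by (auto simp: inj_on_def mid_eq_iff)
  have bij: "bij_betw (\<lambda>x. {g \<in> \<Gamma>. \<sigma> g \<in> x}) (Pow \<Gamma>) (Pow \<Gamma>)"
  proof (rule bij_betwI[where g = "\<lambda>y. \<sigma> ` y"])
    show "(\<lambda>y. \<sigma> ` y) \<in> Pow \<Gamma> \<rightarrow> Pow \<Gamma>" using permutes_image[OF \<sigma>] by auto
    fix x assume "x \<in> Pow \<Gamma>"
    then have "x \<subseteq> \<sigma> ` \<Gamma>" unfolding permutes_image[OF \<sigma>] by simp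
    then show "\<sigma> ` {g \<in> \<Gamma>. \<sigma> g \<in> x} = x" by blast
  next
    fix y assume "y \<in> Pow \<Gamma>"
    then show "{g \<in> \<Gamma>. \<sigma> g \<in> \<sigma> ` y} = y" using permutes_inj[OF \<sigma>] by (auto simp: inj_image_mem_iff)
  qed auto
  have "(\<Sum>T\<in>Pow steps. mean \<Gamma> (\<lambda>r. mean \<Gamma> (\<lambda>x. H (retwist T \<Gamma> \<sigma> x r)))) = (\<Sum>T\<in>Pow steps. H T)" for H :: "(nat \<times> nat) set \<Rightarrow> real"
  proof -
    define H2 where "H2 = (\<lambda>T. mean \<Gamma> (\<lambda>y. H ((T - mid ` \<Gamma>) \<union> mid ` y)))"
    have "mean \<Gamma> (\<lambda>x. H (retwist T \<Gamma> \<sigma> x r)) = H2 ((T - left ` \<Gamma>) \<union> left ` r)" for T r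
      unfolding H2_def mean_def retwist_def
      using sum.reindex_bij_betw[OF bij, of "\<lambda>y. H ((T - left ` \<Gamma>) \<union> left ` r - mid ` \<Gamma> \<union> mid ` y)"] by simp
    then have "(\<Sum>T\<in>Pow steps. mean \<Gamma> (\<lambda>r. mean \<Gamma> (\<lambda>x. H (retwist T \<Gamma> \<sigma> x r))))
       = (\<Sum>T\<in>Pow steps. mean \<Gamma> (\<lambda>r. H2 ((T - left ` \<Gamma>) \<union> left ` r)))" by simp
    also have "\<dots> = (\<Sum>T\<in>Pow steps. H2 T)" by (rule sum_resample[OF finite_steps LM(1) fin inj(1)])
    also have "\<dots> = (\<Sum>T\<in>Pow steps. H T)" unfolding H2_def by (rule sum_resample[OF finite_steps LM(2) fin inj(2)])
    finally show ?thesis .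
  qed
  note inner = this
  have lp: "lift \<sigma> permutes slots" by (rule lift_permutes[OF \<sigma> \<Gamma>])
  have "bij_betw (\<lambda>\<phi>. \<phi> \<circ> lift \<sigma>) {\<phi>. \<phi> permutes slots} {\<phi>. \<phi> permutes slots}"
  proof (rule bij_betwI[where g = "\<lambda>\<phi>. \<phi> \<circ> inv (lift \<sigma>)"])
    show "(\<lambda>\<phi>. \<phi> \<circ> lift \<sigma>) \<in> {\<phi>. \<phi> permutes slots} \<rightarrow> {\<phi>. \<phi> permutes slots}"
      using lp by (auto intro: permutes_compose)
    show "(\<lambda>\<phi>. \<phi> \<circ> inv (lift \<sigma>)) \<in> {\<phi>. \<phi> permutes slots} \<rightarrow> {\<phi>. \<phi> permutes slots}"
      using permutes_inv[OF lp] by (auto intro: permutes_compose)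
  qed (simp_all add: o_assoc[symmetric] permutes_inv_o[OF lp])
  from sum.reindex_bij_betw[OF this, of "\<lambda>\<phi>. \<Sum>T\<in>Pow steps. F \<phi> T"]
  show ?thesis unfolding inner .
qed

end

subsection \<open>Advantage of a deterministic protocol\<close>

context layers
begin

lemma cycle_steps_subset_steps: "c < t \<Longrightarrow> cycle_steps c \<subseteq> steps"
  by (auto simp: cycle_steps_def steps_def)

text \<open>Only the empty set of cycles survives averaging. For \<open>\<epsilon> = 1\<close> and
  \<open>\<epsilon> = - 1\<close> the product is thus the density, relative to uniform
  \<open>T\<close>, of the twists with all parities even, respectively odd.\<close>

lemma mean_prod_sign:
  fixes \<epsilon> :: real
  shows "mean steps (\<lambda>T. \<Prod>c<t. 1 + \<epsilon> * walsh (cycle_steps c) T) = 1"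
proof -
  have disj: "disjoint_family_on cycle_steps S" for S by (auto simp: disjoint_family_on_def cycle_steps_def)
  have "(\<Prod>c<t. 1 + \<epsilon> * walsh (cycle_steps c) T) = (\<Sum>S\<in>Pow {..<t}. \<epsilon> ^ card S * walsh (\<Union>c\<in>S. cycle_steps c) T)" for T
  proof -
    have "(\<Prod>c<t. 1 + \<epsilon> * walsh (cycle_steps c) T) = (\<Sum>S\<in>Pow {..<t}. \<Prod>c\<in>S. \<epsilon> * walsh (cycle_steps c) T)"
      using prod_add[of "{..<t}" "\<lambda>c. \<epsilon> * walsh (cycle_steps c) T" "\<lambda>_. 1"] by (simp add: add.commute)
    also have "\<dots> = (\<Sum>S\<in>Pow {..<t}. \<epsilon> ^ card S * walsh (\<Union>c\<in>S. cycle_steps c) T)"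
    proof (intro sum.cong refl)
      fix S assume "S \<in> Pow {..<t}"
      then have "finite S" by (auto intro: finite_subset)
      then show "(\<Prod>c\<in>S. \<epsilon> * walsh (cycle_steps c) T) = \<epsilon> ^ card S * walsh (\<Union>c\<in>S. cycle_steps c) T"
        using disj by (subst prod_walsh[symmetric]) (auto simp: cycle_steps_def prod.distrib)
    qed
    finally show ?thesis .
  qed
  then have "mean steps (\<lambda>T. \<Prod>c<t. 1 + \<epsilon> * walsh (cycle_steps c) T)
      = (\<Sum>S\<in>Pow {..<t}. \<epsilon> ^ card S * mean steps (walsh (\<Union>c\<in>S. cycle_steps c)))"
    by (simp add: mean_sum mean_cmult)
  also have "\<dots> = (\<Sum>S\<in>Pow {..<t}. if S = {} then 1 else 0)"
  proof (intro sum.cong refl)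
    fix S assume S: "S \<in> Pow {..<t}"
    then have "(\<Union>c\<in>S. cycle_steps c) \<subseteq> steps" using cycle_steps_subset_steps by auto
    moreover have "(\<Union>c\<in>S. cycle_steps c) = {} \<longleftrightarrow> S = {}" using k by (auto simp: cycle_steps_def lessThan_empty_iff)
    ultimately show "\<epsilon> ^ card S * mean steps (walsh (\<Union>c\<in>S. cycle_steps c)) = (if S = {} then 1 else 0)"
      by (simp add: mean_walsh finite_steps)
  qed
  also have "\<dots> = 1" by (simp add: sum.delta)
  finally show ?thesis .
qed

lemma window_subset_strands: "g \<in> windows \<Longrightarrow> window g \<subseteq> strands"
  using window_steps[of g] by (auto simp: window_def strands_def)

lemma disjoint_windows: "g \<noteq> g' \<Longrightarrow> window g \<inter> window g' = {}"
  unfolding window_def using window_neq[of g g'] by (simp add: Times_Int_Times mid_eq_iff)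

lemma card_window: "card (window g) = 6"
  using window_neq[of g g] by (simp add: window_def card_cartesian_product)

text \<open>Windows have disjoint strands, hence are good independently. One of the 64 subsets of
  the six strands is good, so each window contributes
  \<open>1 - (1/2) / 64 = 127/128\<close>.\<close>

lemma mean_half_good:
  assumes c: "c < 2 * t"
  shows "mean strands (\<lambda>a. (1/2) ^ card {g \<in> good a. fst g = c}) = (127/128) ^ nwin"
proof -
  define q where "q = (\<lambda>i b. if b = {mid (c, i)} \<times> (UNIV :: bool set) then 1/2 else 1 :: real)"
  have W: "(c, i) \<in> windows" if "i < nwin" for i using that c by (simp add: windows_def)
  have card: "card {g \<in> good a. fst g = c} = card {i \<in> {..<nwin}. a \<inter> window (c, i) = {mid (c, i)} \<times> UNIV}" for a
  proof -
    have "{g \<in> good a. fst g = c} = Pair c ` {i \<in> {..<nwin}. a \<inter> window (c, i) = {mid (c, i)} \<times> UNIV}"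
      using c by (auto simp: good_def windows_def)
    then show ?thesis by (simp add: card_image inj_on_def)
  qed
  have "(1/2) ^ card {g \<in> good a. fst g = c} = (\<Prod>i<nwin. q i (a \<inter> window (c, i)))" for a
    unfolding card q_def by (subst prod.inter_filter[symmetric]) auto
  then have "mean strands (\<lambda>a. (1/2) ^ card {g \<in> good a. fst g = c}) = mean strands (\<lambda>a. \<Prod>i<nwin. q i (a \<inter> window (c, i)))"
    by simp
  also have "\<dots> = (\<Prod>i<nwin. mean (window (c, i)) (q i))"
    by (rule mean_prod) (use W window_subset_strands finite_strands disjoint_windows in \<open>auto simp: disjoint_family_on_def\<close>)
  also have "\<dots> = (\<Prod>i<nwin. 127/128)"
  proof (intro prod.cong refl)
    fix i
    have fin: "finite (window (c, i))" by (simp add: window_def)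
    have "(\<Sum>b\<in>Pow (window (c, i)). q i b) = (\<Sum>b\<in>Pow (window (c, i)). 1 - (if b = {mid (c, i)} \<times> UNIV then 1/2 else 0))"
      by (intro sum.cong refl) (auto simp: q_def)
    also have "\<dots> = 2 ^ 6 - 1/2"
      using fin by (simp add: sum_subtractf card_Pow card_window sum.delta) (auto simp: window_def)
    finally show "mean (window (c, i)) (q i) = 127/128" by (simp add: mean_def card_window)
  qed
  finally show ?thesis by simp
qed

definition bad :: "nat \<Rightarrow> ((nat \<times> nat) \<times> bool) set set" where
  "bad h = {a \<in> Pow strands. \<exists>c<2 * t. card {g \<in> good a. fst g = c} < h}"

text \<open>Markov's inequality for \<open>(1/2) ^ N a c\<close>, and a union bound over the
  \<open>2 * t\<close> components.\<close>

lemma card_bad_le: "real (card (bad h)) \<le> 2 * real t * 2 ^ h * (127/128) ^ nwin * 2 ^ card strands"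
proof -
  define N where "N = (\<lambda>a c. card {g \<in> good a. fst g = c})"
  have pt: "1 \<le> (\<Sum>c<2 * t. 2 ^ h * (1/2 :: real) ^ N a c)" if a: "a \<in> bad h" for a
  proof -
    obtain c where c: "c < 2 * t" "N a c < h" using a by (auto simp: bad_def N_def)
    have "(1 :: real) \<le> 2 ^ (h - N a c)" by simp
    also have "\<dots> = 2 ^ h * (1/2) ^ N a c" using c by (simp add: power_diff power_one_over field_simps)
    also have "\<dots> \<le> (\<Sum>c<2 * t. 2 ^ h * (1/2) ^ N a c)"
      using c by (intro member_le_sum) auto
    finally show ?thesis .
  qed
  have "real (card (bad h)) = (\<Sum>a\<in>bad h. 1)" by simp
  also have "\<dots> \<le> (\<Sum>a\<in>bad h. \<Sum>c<2 * t. 2 ^ h * (1/2) ^ N a c)" by (intro sum_mono pt)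
  also have "\<dots> \<le> (\<Sum>a\<in>Pow strands. \<Sum>c<2 * t. 2 ^ h * (1/2) ^ N a c)"
    by (rule sum_mono2) (auto simp: finite_strands bad_def intro!: sum_nonneg)
  also have "\<dots> = (\<Sum>c<2 * t. 2 ^ h * (\<Sum>a\<in>Pow strands. (1/2) ^ N a c))"
    by (subst sum.swap) (simp add: sum_distrib_left)
  also have "\<dots> = (\<Sum>c<2 * t. 2 ^ h * ((127/128) ^ nwin * 2 ^ card strands))"
  proof (intro sum.cong refl)
    fix c assume "c \<in> {..<2 * t}"
    then have "mean strands (\<lambda>a. (1/2) ^ N a c) = (127/128) ^ nwin" unfolding N_def by (intro mean_half_good) simp
    then show "2 ^ h * (\<Sum>a\<in>Pow strands. (1/2 :: real) ^ N a c) = 2 ^ h * ((127/128) ^ nwin * 2 ^ card strands)"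
      by (simp add: mean_def field_simps)
  qed
  finally show ?thesis by simp
qed

text \<open>The odd density minus the even density; it vanishes wherever the promise fails.\<close>

definition gap :: "(nat \<times> nat) set \<Rightarrow> real" where
  "gap T = (\<Prod>c<t. 1 - walsh (cycle_steps c) T) - (\<Prod>c<t. 1 + walsh (cycle_steps c) T)"

definition answer :: "(edge set \<Rightarrow> 'm) \<Rightarrow> ('m \<Rightarrow> edge set \<Rightarrow> bool) \<Rightarrow> ((nat \<times> nat) \<times> bool) set \<Rightarrow>
    (nat \<times> nat \<Rightarrow> nat \<times> nat) \<Rightarrow> (nat \<times> nat) set \<Rightarrow> bool" where
  "answer A B a \<phi> T = B (A (link \<phi> T ` a)) (link \<phi> T ` (strands - a))"

lemma walsh_le_1: "walsh u x \<le> 1" "- 1 \<le> walsh u x"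
  by (auto simp: walsh_def minus_one_power_iff)

text \<open>The trivial bound, used for partitions with too few good windows: the subtracted density
  is dropped.\<close>

lemma advantage_le:
  "(\<Sum>\<phi> | \<phi> permutes slots. \<Sum>T\<in>Pow steps. of_bool (answer A B a \<phi> T) * gap T) \<le> fact (card slots) * 2 ^ card steps"
proof -
  have pos: "0 \<le> (\<Prod>c<t. 1 - walsh (cycle_steps c) T)" "0 \<le> (\<Prod>c<t. 1 + walsh (cycle_steps c) T)" for T
  proof -
    have "0 \<le> 1 - walsh u T" "0 \<le> 1 + walsh u T" for u :: "(nat \<times> nat) set"
      using walsh_le_1[of u T] by linarith+
    then show "0 \<le> (\<Prod>c<t. 1 - walsh (cycle_steps c) T)" "0 \<le> (\<Prod>c<t. 1 + walsh (cycle_steps c) T)"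
      by (auto intro!: prod_nonneg)
  qed
  have "(\<Sum>\<phi> | \<phi> permutes slots. \<Sum>T\<in>Pow steps. of_bool (answer A B a \<phi> T) * gap T)
      \<le> (\<Sum>\<phi> | \<phi> permutes slots. \<Sum>T\<in>Pow steps. \<Prod>c<t. 1 + (- 1) * walsh (cycle_steps c) T)"
    using pos by (intro sum_mono) (auto simp: gap_def)
  also have "\<dots> = (\<Sum>\<phi> | \<phi> permutes slots. 2 ^ card steps)"
    using mean_prod_sign[of "- 1"] by (simp add: mean_def)
  also have "\<dots> = fact (card slots) * 2 ^ card steps" by (simp add: card_permutations finite_slots)
  finally show ?thesis .
qed

lemma advantage_good_le:
  fixes A :: "edge set \<Rightarrow> 'm" and h :: nat
  assumes a: "a \<in> Pow strands - bad h" and h: "h > 0"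
    and M: "finite M" "\<And>E. A E \<in> M" "real (card M) \<le> 2 powr (real h * real t / 64)"
    and small: "real t * 2 powr (- 3 * real h / 4) \<le> 1/800"
  shows "(\<Sum>\<phi> | \<phi> permutes slots. \<Sum>T\<in>Pow steps. of_bool (answer A B a \<phi> T) * gap T) \<le> fact (card slots) * 2 ^ card steps / 10"
proof -
  \<comment> \<open>Exactly \<open>h\<close> good windows are kept in every component, so that all
    hidden parities have equal size and half of \<open>\<Gamma>\<close> lies on paths.\<close>
  have "\<forall>c. \<exists>C. c < 2 * t \<longrightarrow> C \<subseteq> {g \<in> good a. fst g = c} \<and> card C = h"
  proof (intro allI)
    fix c
    show "\<exists>C. c < 2 * t \<longrightarrow> C \<subseteq> {g \<in> good a. fst g = c} \<and> card C = h"
    proof (cases "c < 2 * t")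
      case True
      have "\<not> (\<exists>c<2 * t. card {g \<in> good a. fst g = c} < h)" using a by (simp add: bad_def)
      with True have "\<not> card {g \<in> good a. fst g = c} < h" by blast
      then have "h \<le> card {g \<in> good a. fst g = c}" by (rule leI)
      then show ?thesis by (meson obtain_subset_with_card_n)
    qed simp
  qed
  then obtain C where C: "\<And>c. c < 2 * t \<Longrightarrow> C c \<subseteq> {g \<in> good a. fst g = c}" "\<And>c. c < 2 * t \<Longrightarrow> card (C c) = h"
    by metis
  define \<Gamma> where "\<Gamma> = (\<Union>c<2 * t. C c)"
  have \<Gamma>: "\<Gamma> \<subseteq> good a" using C(1) by (auto simp: \<Gamma>_def)
  then have \<Gamma>W: "\<Gamma> \<subseteq> windows" by (auto simp: good_def)
  have fin: "finite \<Gamma>" using finite_subset[OF \<Gamma>W finite_windows] .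
  have comp: "{g \<in> \<Gamma>. fst g = c} = C c" if "c < 2 * t" for c using C(1) that by (auto simp: \<Gamma>_def)
  have "card \<Gamma> = (\<Sum>c<2 * t. card (C c))"
    unfolding \<Gamma>_def
  proof (rule card_UN_disjoint)
    show "\<forall>c\<in>{..<2 * t}. finite (C c)" using fin by (auto simp: \<Gamma>_def intro: finite_subset)
    show "\<forall>i\<in>{..<2 * t}. \<forall>j\<in>{..<2 * t}. i \<noteq> j \<longrightarrow> C i \<inter> C j = {}" using C(1) by blast
  qed simp
  then have card\<Gamma>: "card \<Gamma> = 2 * t * h" using C(2) by simp
  define G where "G = (\<lambda>c. {g \<in> \<Gamma>. fst g = c})"
  define F where "F = (\<lambda>\<phi> T. of_bool (answer A B a \<phi> T) * gap T)"
  have aSE: "a \<subseteq> strands" using a by simp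
  have step: "(\<Sum>\<sigma> | \<sigma> permutes \<Gamma>. mean \<Gamma> (\<lambda>r. mean \<Gamma> (\<lambda>x. F (\<phi> \<circ> lift \<sigma>) (retwist T \<Gamma> \<sigma> x r)))) \<le> fact (card \<Gamma>) / 10"
    if "\<phi> permutes slots" "T \<subseteq> steps" for \<phi> T
  proof -
    define msg where "msg = (\<lambda>x. A (link \<phi> (retwist T \<Gamma> id x {}) ` a))"
    define \<beta> where "\<beta> = (\<lambda>m \<sigma> r. of_bool (B m (link (\<phi> \<circ> lift \<sigma>) (retwist T \<Gamma> \<sigma> {} r) ` (strands - a))) :: real)"
    define \<kappa> where "\<kappa> = (\<lambda>c. walsh (cycle_steps c) (T - left ` \<Gamma> - mid ` \<Gamma>))"
    have "(\<Sum>\<sigma> | \<sigma> permutes \<Gamma>. mean \<Gamma> (\<lambda>r. mean \<Gamma> (\<lambda>x. F (\<phi> \<circ> lift \<sigma>) (retwist T \<Gamma> \<sigma> x r))))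
      = (\<Sum>\<sigma> | \<sigma> permutes \<Gamma>. mean \<Gamma> (\<lambda>r. mean \<Gamma> (\<lambda>x. \<beta> (msg x) \<sigma> r *
          ((\<Prod>c<t. 1 - \<kappa> c * walsh (G c) r * walsh (\<sigma> ` G c) x) - (\<Prod>c<t. 1 + \<kappa> c * walsh (G c) r * walsh (\<sigma> ` G c) x)))))"
    proof (intro sum.cong refl mean_cong)
      fix \<sigma> r x assume "\<sigma> \<in> {\<sigma>. \<sigma> permutes \<Gamma>}" and xr: "x \<subseteq> \<Gamma>" "r \<subseteq> \<Gamma>"
      then have \<sigma>: "\<sigma> permutes \<Gamma>" by simp
      have "answer A B a (\<phi> \<circ> lift \<sigma>) (retwist T \<Gamma> \<sigma> x r)
          = B (msg x) (link (\<phi> \<circ> lift \<sigma>) (retwist T \<Gamma> \<sigma> {} r) ` (strands - a))"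
        unfolding answer_def alice_edges[OF \<Gamma> \<sigma> xr(2) aSE] bob_edges[OF \<Gamma>, of _ T \<sigma> x r] msg_def ..
      moreover have "gap (retwist T \<Gamma> \<sigma> x r) = (\<Prod>c<t. 1 - \<kappa> c * walsh (G c) r * walsh (\<sigma> ` G c) x)
          - (\<Prod>c<t. 1 + \<kappa> c * walsh (G c) r * walsh (\<sigma> ` G c) x)"
        unfolding gap_def walsh_retwist[OF \<Gamma>W \<sigma> xr] \<kappa>_def G_def ..
      ultimately show "F (\<phi> \<circ> lift \<sigma>) (retwist T \<Gamma> \<sigma> x r) = \<beta> (msg x) \<sigma> r *
          ((\<Prod>c<t. 1 - \<kappa> c * walsh (G c) r * walsh (\<sigma> ` G c) x) - (\<Prod>c<t. 1 + \<kappa> c * walsh (G c) r * walsh (\<sigma> ` G c) x))"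
        unfolding F_def \<beta>_def by simp
    qed
    also have "\<dots> \<le> fact (card \<Gamma>) / 10"
    proof (rule hidden_parity_advantage_le[OF fin card\<Gamma> t h _ _ _ M(1) _ M(3) small])
      show "G c \<subseteq> \<Gamma>" for c by (auto simp: G_def)
      show "card (G c) = h" if "c < t" for c using that comp[of c] C(2)[of c] by (simp add: G_def)
      show "disjoint_family_on G {..<t}" by (auto simp: disjoint_family_on_def G_def)
      show "msg x \<in> M" for x by (simp add: msg_def M)
      show "0 \<le> \<beta> m \<sigma> r \<and> \<beta> m \<sigma> r \<le> 1" for m \<sigma> r by (simp add: \<beta>_def)
      show "\<bar>\<kappa> c\<bar> = 1" for c by (simp add: \<kappa>_def walsh_def power_abs)
    qed
    finally show ?thesis .
  qed
  \<comment> \<open>A dummy sum over \<open>\<sigma>\<close> is introduced, absorbed by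
    \<open>sum_retwist\<close>, and moved inside; each \<open>\<phi>\<close> and \<open>T\<close>
    then carries its own hidden parity instance.\<close>
  have "fact (card \<Gamma>) * (\<Sum>\<phi> | \<phi> permutes slots. \<Sum>T\<in>Pow steps. F \<phi> T)
     = (\<Sum>\<sigma> | \<sigma> permutes \<Gamma>. \<Sum>\<phi> | \<phi> permutes slots. \<Sum>T\<in>Pow steps. F \<phi> T)"
    by (simp add: card_permutations fin)
  also have "\<dots> = (\<Sum>\<sigma> | \<sigma> permutes \<Gamma>. \<Sum>\<phi> | \<phi> permutes slots. \<Sum>T\<in>Pow steps.
      mean \<Gamma> (\<lambda>r. mean \<Gamma> (\<lambda>x. F (\<phi> \<circ> lift \<sigma>) (retwist T \<Gamma> \<sigma> x r))))"
    by (intro sum.cong refl sum_retwist[OF \<Gamma>W, symmetric]) simp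
  also have "\<dots> = (\<Sum>\<phi> | \<phi> permutes slots. \<Sum>\<sigma> | \<sigma> permutes \<Gamma>. \<Sum>T\<in>Pow steps.
      mean \<Gamma> (\<lambda>r. mean \<Gamma> (\<lambda>x. F (\<phi> \<circ> lift \<sigma>) (retwist T \<Gamma> \<sigma> x r))))"
    by (rule sum.swap)
  also have "\<dots> = (\<Sum>\<phi> | \<phi> permutes slots. \<Sum>T\<in>Pow steps. \<Sum>\<sigma> | \<sigma> permutes \<Gamma>.
      mean \<Gamma> (\<lambda>r. mean \<Gamma> (\<lambda>x. F (\<phi> \<circ> lift \<sigma>) (retwist T \<Gamma> \<sigma> x r))))"
    by (intro sum.cong refl sum.swap)
  also have "\<dots> \<le> (\<Sum>\<phi> | \<phi> permutes slots. \<Sum>T\<in>Pow steps. fact (card \<Gamma>) / 10)"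
    by (intro sum_mono step) auto
  also have "\<dots> = fact (card \<Gamma>) * (fact (card slots) * 2 ^ card steps / 10)"
    by (simp add: card_permutations finite_slots card_Pow finite_steps)
  finally show ?thesis unfolding F_def by (subst (asm) mult_le_cancel_left_pos) auto
qed

lemma total_advantage_le:
  fixes A :: "edge set \<Rightarrow> 'm" and h :: nat
  assumes h: "h > 0"
    and M: "finite M" "\<And>E. A E \<in> M" "real (card M) \<le> 2 powr (real h * real t / 64)"
    and small: "real t * 2 powr (- 3 * real h / 4) \<le> 1/800"
    and few: "2 * real t * 2 ^ h * (127/128) ^ nwin \<le> 1/10"
  shows "(\<Sum>a\<in>Pow strands. \<Sum>\<phi> | \<phi> permutes slots. \<Sum>T\<in>Pow steps. of_bool (answer A B a \<phi> T) * gap T)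
    \<le> 2 ^ card strands * (fact (card slots) * 2 ^ card steps) / 5"
proof -
  define V where "V = fact (card slots) * (2 :: real) ^ card steps"
  define S where "S = (\<lambda>a. \<Sum>\<phi> | \<phi> permutes slots. \<Sum>T\<in>Pow steps. of_bool (answer A B a \<phi> T) * gap T)"
  have V: "V \<ge> 0" by (simp add: V_def)
  have bad: "bad h \<subseteq> Pow strands" by (auto simp: bad_def)
  have "(\<Sum>a\<in>Pow strands. S a) = (\<Sum>a\<in>Pow strands - bad h. S a) + (\<Sum>a\<in>bad h. S a)"
    by (rule sum.subset_diff[OF bad]) (simp add: finite_strands)
  also have "\<dots> \<le> (\<Sum>a\<in>Pow strands - bad h. V / 10) + (\<Sum>a\<in>bad h. V)"
    unfolding S_def V_def by (intro add_mono sum_mono advantage_good_le[OF _ h M small] advantage_le) auto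
  also have "(\<Sum>a\<in>Pow strands - bad h. V / 10) \<le> (\<Sum>a\<in>Pow strands. V / 10)"
    using V by (intro sum_mono2) (auto simp: finite_strands)
  also have "(\<Sum>a\<in>Pow strands. V / 10) + (\<Sum>a\<in>bad h. V) = 2 ^ card strands * V / 10 + real (card (bad h)) * V"
    by (simp add: card_Pow finite_strands)
  also have "real (card (bad h)) * V \<le> (1/10 * 2 ^ card strands) * V"
    using order_trans[OF card_bad_le[of h] mult_right_mono[OF few, of "2 ^ card strands"]] V by (intro mult_right_mono) auto
  finally show ?thesis unfolding S_def V_def by (simp add: field_simps)
qed

end

subsection \<open>Randomised protocols\<close>

lemma prob_space_coin_space: "prob_space coin_space"
  unfolding coin_space_def by (intro prob_space_PiM measure_pmf.prob_space_axioms)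

lemma space_coin_space: "space coin_space = UNIV"
  unfolding coin_space_def by (simp add: space_PiM)

lemma answer_measurable:
  assumes "protocol A B"
  shows "{R. B (A F R) E R = ans} \<in> sets coin_space"
proof -
  have "(\<lambda>R. B (A F R) E R) \<in> measurable coin_space (count_space UNIV)"
    \<comment> \<open>Messages form a countable type, which makes the composition
      measurable.\<close>
    using assms unfolding protocol_def
    by (intro measurable_compose_countable[where f = "\<lambda>msg R. B msg E R" and g = "A F"]) auto
  from measurable_sets[OF this, of "{ans}"] show ?thesis
    by (simp add: vimage_def space_coin_space)
qed

text \<open>Alice's set is a uniform subset of \<open>E\<close>; cutting the event into one
  rectangle per value of this set reduces the product measure to a finite sum.\<close>

lemma success_prob_eq:
  assumes AB: "protocol A B" and E: "finite E"
  shows "success_prob A B E ans = (\<Sum>F\<in>Pow E. measure coin_space {R. B (A F R) (E - F) R = ans}) / 2 ^ card E"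
proof -
  interpret C: prob_space coin_space by (rule prob_space_coin_space)
  define p where "p = edge_assignment E"
  define Q where "Q = (\<lambda>F. {s. {e \<in> E. s e} = F} \<times> {R. B (A F R) (E - F) R = ans})"
  interpret P: pair_prob_space "measure_pmf p" coin_space ..
  have sets: "Q F \<in> sets (measure_pmf p \<Otimes>\<^sub>M coin_space)" for F
    unfolding Q_def using answer_measurable[OF AB] by (intro pair_measureI) auto
  have eq: "{(s, R). B (A {e \<in> E. s e} R) {e \<in> E. \<not> s e} R = ans} = (\<Union>F\<in>Pow E. Q F)"
  proof (rule set_eqI)
    fix z :: "(edge \<Rightarrow> bool) \<times> coins"
    obtain s R where z: "z = (s, R)" by (cases z)
    define S where "S = {e \<in> E. s e}"
    have S: "S \<in> Pow E" "{e \<in> E. \<not> s e} = E - S" by (auto simp: S_def)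
    have zQ: "z \<in> Q F \<longleftrightarrow> S = F \<and> B (A F R) (E - F) R = ans" for F by (simp add: z Q_def S_def)
    have "z \<in> {(s, R). B (A {e \<in> E. s e} R) {e \<in> E. \<not> s e} R = ans} \<longleftrightarrow> B (A S R) (E - S) R = ans"
      by (simp only: z mem_Collect_eq prod.case S(2)) (simp only: S_def)
    also have "\<dots> \<longleftrightarrow> (\<exists>F\<in>Pow E. S = F \<and> B (A F R) (E - F) R = ans)" using S(1) by simp
    finally show "z \<in> {(s, R). B (A {e \<in> E. s e} R) {e \<in> E. \<not> s e} R = ans} \<longleftrightarrow> z \<in> (\<Union>F\<in>Pow E. Q F)"
      by (simp only: UN_iff zQ)
  qed
  have "success_prob A B E ans = measure (measure_pmf p \<Otimes>\<^sub>M coin_space) (\<Union>F\<in>Pow E. Q F)"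
    unfolding success_prob_def p_def eq ..
  also have "\<dots> = (\<Sum>F\<in>Pow E. measure (measure_pmf p \<Otimes>\<^sub>M coin_space) (Q F))"
    using E sets by (intro P.finite_measure_finite_Union) (auto simp: disjoint_family_on_def Q_def)
  also have "\<dots> = (\<Sum>F\<in>Pow E. measure coin_space {R. B (A F R) (E - F) R = ans} / 2 ^ card E)"
  proof (intro sum.cong refl)
    fix F assume F: "F \<in> Pow E"
    have "measure (measure_pmf p) {s. {e \<in> E. s e} = F} = measure (measure_pmf (map_pmf (\<lambda>s. {e \<in> E. s e}) p)) {F}"
      by (simp add: vimage_def)
    also have "map_pmf (\<lambda>s. {e \<in> E. s e}) p = pmf_of_set (Pow E)"
      unfolding p_def edge_assignment_def using E by (rule pmf_of_set_Pow_conv_bernoulli)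
    also have "measure (measure_pmf (pmf_of_set (Pow E))) {F} = 1 / 2 ^ card E"
      using E F unfolding measure_pmf_single by (subst pmf_of_set) (auto simp: card_Pow)
    finally have pF: "measure (measure_pmf p) {s. {e \<in> E. s e} = F} = 1 / 2 ^ card E" .
    have "measure (measure_pmf p \<Otimes>\<^sub>M coin_space) (Q F)
        = measure (measure_pmf p) {s. {e \<in> E. s e} = F} * measure coin_space {R. B (A F R) (E - F) R = ans}"
      unfolding Q_def using answer_measurable[OF AB]
      by (simp add: measure_def C.emeasure_pair_measure_Times enn2real_mult)
    then show "measure (measure_pmf p \<Otimes>\<^sub>M coin_space) (Q F) = measure coin_space {R. B (A F R) (E - F) R = ans} / 2 ^ card E"
      by (simp add: pF)
  qed
  finally show ?thesis by (simp add: sum_divide_distrib)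
qed

context layers
begin

lemma card_graph: "\<phi> permutes slots \<Longrightarrow> card (graph \<phi> T) = card strands"
  unfolding graph_def by (rule card_image[OF inj_on_link])

lemma success_prob_graph:
  assumes AB: "protocol A B" and \<phi>: "\<phi> permutes slots"
  shows "success_prob A B (graph \<phi> T) ans
    = (\<Sum>a\<in>Pow strands. measure coin_space {R. answer (\<lambda>E. A E R) (\<lambda>m E. B m E R) a \<phi> T = ans}) / 2 ^ card strands"
proof -
  have inj: "inj_on (link \<phi> T) strands" by (rule inj_on_link[OF \<phi>])
  have bij: "bij_betw ((`) (link \<phi> T)) (Pow strands) (Pow (graph \<phi> T))"
    using inj unfolding graph_def by (intro bij_betw_Pow) (simp add: bij_betw_def)
  have diff: "graph \<phi> T - link \<phi> T ` a = link \<phi> T ` (strands - a)" if "a \<in> Pow strands" for a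
    unfolding graph_def using inj_on_image_set_diff[OF inj, of strands a] that by auto
  have "finite (graph \<phi> T)" by (simp add: graph_def finite_strands)
  then have "success_prob A B (graph \<phi> T) ans
     = (\<Sum>F\<in>Pow (graph \<phi> T). measure coin_space {R. B (A F R) (graph \<phi> T - F) R = ans}) / 2 ^ card strands"
    using success_prob_eq[OF AB] card_graph[OF \<phi>] by simp
  also have "(\<Sum>F\<in>Pow (graph \<phi> T). measure coin_space {R. B (A F R) (graph \<phi> T - F) R = ans})
     = (\<Sum>a\<in>Pow strands. measure coin_space {R. B (A (link \<phi> T ` a) R) (graph \<phi> T - link \<phi> T ` a) R = ans})"
    by (rule sum.reindex_bij_betw[OF bij, symmetric])
  finally show ?thesis by (simp add: answer_def diff)
qed

lemma prod_walsh_cases: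
  assumes "s = 1 \<or> s = - 1"
  shows "(\<Prod>c<t. 1 + s * walsh (cycle_steps c) T) = (if \<forall>c<t. walsh (cycle_steps c) T = s then 2 ^ t else 0)"
proof (cases "\<forall>c<t. walsh (cycle_steps c) T = s")
  case True
  then have "(\<Prod>c<t. 1 + s * walsh (cycle_steps c) T) = (\<Prod>c<t. 2)" using assms by (intro prod.cong) auto
  then show ?thesis using True by simp
next
  case False
  then obtain c where c: "c < t" "walsh (cycle_steps c) T \<noteq> s" by auto
  have "walsh (cycle_steps c) T = 1 \<or> walsh (cycle_steps c) T = - 1" by (auto simp: walsh_def minus_one_power_iff)
  then have "1 + s * walsh (cycle_steps c) T = 0" using c assms by auto
  then have "(\<Prod>c<t. 1 + s * walsh (cycle_steps c) T) = 0" using c by (intro prod_zero) auto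
  then show ?thesis using False by (simp only: if_False)
qed

lemma walsh_cycle_steps: "walsh (cycle_steps c) T = 1 \<longleftrightarrow> even (card (T \<inter> cycle_steps c))" "walsh (cycle_steps c) T = - 1 \<longleftrightarrow> odd (card (T \<inter> cycle_steps c))"
  by (auto simp: walsh_def minus_one_power_iff Int_commute)

lemma no_cheap_protocol:
  fixes h L :: nat
  assumes AB: "protocol A B" and err: "has_error (NGC (4 * t * k) k) (1/3) A B"
    and len: "\<And>E ans F R. (E, ans) \<in> NGC (4 * t * k) k \<Longrightarrow> F \<subseteq> E \<Longrightarrow> length (A F R) \<le> L"
    and h: "h > 0" and L: "real (L + 1) \<le> real h * real t / 64"
    and small: "real t * 2 powr (- 3 * real h / 4) \<le> 1/800"
    and few: "2 * real t * 2 ^ h * (127/128) ^ nwin \<le> 1/10"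
  shows False
proof -
  interpret C: prob_space coin_space by (rule prob_space_coin_space)
  \<comment> \<open>Most of the random graphs violate the promise; on those Alice's message may be long.\<close>
  define A' where "A' = (\<lambda>F R. take L (A F R))"
  define M where "M = {l :: bool list. length l \<le> L}"
  define ans where "ans = (\<lambda>R. answer (\<lambda>E. A' E R) (\<lambda>m E. B m E R))"
  define V where "V = fact (card slots) * (2 :: real) ^ card steps"
  have AB': "protocol A' B"
    using AB unfolding protocol_def A'_def by (auto intro: measurable_compose[where g = "take L"])
  have M: "finite M" "card M \<le> 2 ^ (L + 1)"
  proof -
    have eq: "M = {l. set l \<subseteq> (UNIV :: bool set) \<and> length l \<le> L}" by (simp add: M_def)
    show "finite M" unfolding eq by (rule finite_lists_length_le) simp
    have "card M = (\<Sum>i\<le>L. 2 ^ i)" unfolding eq by (subst card_lists_length_le) (auto simp: numeral_2_eq_2)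
    also have "\<dots> \<le> 2 ^ (L + 1)" by (induction L) auto
    finally show "card M \<le> 2 ^ (L + 1)" .
  qed
  have "real (card M) \<le> real (2 ^ (L + 1))" using M(2) by (rule of_nat_mono)
  also have "\<dots> = 2 powr real (L + 1)" by (subst powr_realpow) auto
  also have "\<dots> \<le> 2 powr (real h * real t / 64)" using L by (intro powr_mono) auto
  finally have M3: "real (card M) \<le> 2 powr (real h * real t / 64)" .
  define m where "m = (\<lambda>a \<phi> T b. measure coin_space {R. ans R a \<phi> T = b})"
  have meas: "{R. ans R a \<phi> T = b} \<in> sets coin_space" for a \<phi> T b
    unfolding ans_def answer_def by (rule answer_measurable[OF AB'])
  have succ: "(\<Sum>a\<in>Pow strands. m a \<phi> T b) \<ge> 2/3 * 2 ^ card strands"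
    if \<phi>: "\<phi> permutes slots" and N: "(graph \<phi> T, b) \<in> NGC (4 * t * k) k" for \<phi> T b
  proof -
    have "2/3 \<le> success_prob A B (graph \<phi> T) b" using err N by (force simp: has_error_def)
    also have "\<dots> = (\<Sum>a\<in>Pow strands. measure coin_space {R. answer (\<lambda>E. A E R) (\<lambda>m E. B m E R) a \<phi> T = b}) / 2 ^ card strands"
      by (rule success_prob_graph[OF AB \<phi>])
    also have "\<dots> = (\<Sum>a\<in>Pow strands. m a \<phi> T b) / 2 ^ card strands"
    proof -
      have "A' (link \<phi> T ` a) R = A (link \<phi> T ` a) R" if "a \<in> Pow strands" for a R
      proof -
        have "link \<phi> T ` a \<subseteq> graph \<phi> T" using that by (auto simp: graph_def)
        then show ?thesis using len[OF N] by (simp add: A'_def)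
      qed
      then show ?thesis by (simp add: m_def ans_def answer_def)
    qed
    finally show ?thesis by (simp add: field_simps)
  qed
  have compl: "m a \<phi> T True = 1 - m a \<phi> T False" for a \<phi> T
  proof -
    have "{R. ans R a \<phi> T = True} = space coin_space - {R. ans R a \<phi> T = False}" by (auto simp: space_coin_space)
    then show ?thesis unfolding m_def using C.prob_compl[OF meas[of a \<phi> T False]] by (simp only:)
  qed
  \<comment> \<open>With all parities odd the answer is \<open>True\<close> with probability at
    least 2/3; with all even it is so with probability at most 1/3, and \<open>gap\<close> is
    negative; otherwise both sides are 0.\<close>
  have pt: "2 ^ card strands * (2/3 * (\<Prod>c<t. 1 + (- 1) * walsh (cycle_steps c) T) - 1/3 * (\<Prod>c<t. 1 + 1 * walsh (cycle_steps c) T))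
      \<le> (\<Sum>a\<in>Pow strands. m a \<phi> T True) * gap T" if \<phi>: "\<phi> permutes slots" for \<phi> T
  proof -
    have g: "gap T = (\<Prod>c<t. 1 + (- 1) * walsh (cycle_steps c) T) - (\<Prod>c<t. 1 + 1 * walsh (cycle_steps c) T)"
      by (simp add: gap_def)
    consider (od) "\<forall>c<t. walsh (cycle_steps c) T = - 1" | (ev) "\<forall>c<t. walsh (cycle_steps c) T = 1"
      | (no) "\<not> (\<forall>c<t. walsh (cycle_steps c) T = - 1)" "\<not> (\<forall>c<t. walsh (cycle_steps c) T = 1)" by blast
    then show ?thesis
    proof cases
      case od
      then have "\<not> (\<forall>c<t. walsh (cycle_steps c) T = 1)" using t by force
      then have P: "(\<Prod>c<t. 1 + (- 1) * walsh (cycle_steps c) T) = 2 ^ t" "(\<Prod>c<t. 1 + 1 * walsh (cycle_steps c) T) = 0"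
        using od prod_walsh_cases[of "- 1" T] prod_walsh_cases[of 1 T] by auto
      have "(graph \<phi> T, True) \<in> NGC (4 * t * k) k" using od by (intro NGC_graph(1)[OF \<phi>]) (simp add: walsh_cycle_steps)
      from mult_right_mono[OF succ[OF \<phi> this], of "2 ^ t"] show ?thesis unfolding g P by (simp add: mult_ac)
    next
      case ev
      then have "\<not> (\<forall>c<t. walsh (cycle_steps c) T = - 1)" using t by force
      then have P: "(\<Prod>c<t. 1 + (- 1) * walsh (cycle_steps c) T) = 0" "(\<Prod>c<t. 1 + 1 * walsh (cycle_steps c) T) = 2 ^ t"
        using ev prod_walsh_cases[of "- 1" T] prod_walsh_cases[of 1 T] by auto
      have N: "(graph \<phi> T, False) \<in> NGC (4 * t * k) k" using ev by (intro NGC_graph(2)[OF \<phi>]) (simp add: walsh_cycle_steps)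
      have "(\<Sum>a\<in>Pow strands. m a \<phi> T True) = 2 ^ card strands - (\<Sum>a\<in>Pow strands. m a \<phi> T False)"
        by (simp add: compl sum_subtractf card_Pow finite_strands)
      also have "\<dots> \<le> 1/3 * 2 ^ card strands" using succ[OF \<phi> N] by simp
      finally have "(\<Sum>a\<in>Pow strands. m a \<phi> T True) * 2 ^ t \<le> (1/3 * 2 ^ card strands) * 2 ^ t" by (rule mult_right_mono) simp
      then show ?thesis unfolding g P by (simp add: mult_ac)
    next
      case no
      then have P: "(\<Prod>c<t. 1 + (- 1) * walsh (cycle_steps c) T) = 0" "(\<Prod>c<t. 1 + 1 * walsh (cycle_steps c) T) = 0"
        using prod_walsh_cases[of "- 1" T] prod_walsh_cases[of 1 T] by auto
      show ?thesis unfolding g P by simp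
    qed
  qed
  have ind: "(\<lambda>R. of_bool (ans R a \<phi> T) * gap T) = (\<lambda>R. indicator {R. ans R a \<phi> T = True} R * gap T)" for a \<phi> T
    by (auto simp: indicator_def)
  have int: "integrable coin_space (\<lambda>R. of_bool (ans R a \<phi> T) * gap T)" for a \<phi> T
    unfolding ind using meas[of a \<phi> T True]
    by (intro integrable_mult_left integrable_real_indicator) (auto simp: C.emeasure_eq_measure)
  have expect: "m a \<phi> T True * gap T = (\<integral>R. of_bool (ans R a \<phi> T) * gap T \<partial>coin_space)" for a \<phi> T
    unfolding ind m_def using meas[of a \<phi> T True] by (simp add: space_coin_space)
  have sign: "(\<Sum>T\<in>Pow steps. \<Prod>c<t. 1 + s * walsh (cycle_steps c) T) = 2 ^ card steps" for s :: real
    using mean_prod_sign[of s] by (simp add: mean_def)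
  have "2 ^ card strands * V / 3 = (\<Sum>\<phi> | \<phi> permutes slots. 2 ^ card strands * (2/3 * 2 ^ card steps - 1/3 * 2 ^ card steps))"
    by (simp add: V_def card_permutations finite_slots)
  also have "\<dots> = (\<Sum>\<phi> | \<phi> permutes slots. \<Sum>T\<in>Pow steps. 2 ^ card strands *
      (2/3 * (\<Prod>c<t. 1 + (- 1) * walsh (cycle_steps c) T) - 1/3 * (\<Prod>c<t. 1 + 1 * walsh (cycle_steps c) T)))"
    unfolding sum_distrib_left[symmetric] sum_subtractf sign ..
  also have "\<dots> \<le> (\<Sum>\<phi> | \<phi> permutes slots. \<Sum>T\<in>Pow steps. (\<Sum>a\<in>Pow strands. m a \<phi> T True) * gap T)"
    by (intro sum_mono pt) auto
  also have "\<dots> = (\<Sum>\<phi> | \<phi> permutes slots. \<Sum>T\<in>Pow steps. \<Sum>a\<in>Pow strands. m a \<phi> T True * gap T)"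
    by (simp add: sum_distrib_right)
  also have "\<dots> = (\<Sum>\<phi> | \<phi> permutes slots. \<Sum>a\<in>Pow strands. \<Sum>T\<in>Pow steps. m a \<phi> T True * gap T)"
    by (intro sum.cong refl sum.swap)
  also have "\<dots> = (\<Sum>a\<in>Pow strands. \<Sum>\<phi> | \<phi> permutes slots. \<Sum>T\<in>Pow steps. m a \<phi> T True * gap T)"
    by (rule sum.swap)
  also have "\<dots> = (\<Sum>a\<in>Pow strands. \<Sum>\<phi> | \<phi> permutes slots. \<Sum>T\<in>Pow steps. \<integral>R. of_bool (ans R a \<phi> T) * gap T \<partial>coin_space)"
    by (simp only: expect)
  also have "\<dots> = (\<integral>R. (\<Sum>a\<in>Pow strands. \<Sum>\<phi> | \<phi> permutes slots. \<Sum>T\<in>Pow steps. of_bool (ans R a \<phi> T) * gap T) \<partial>coin_space)"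
    by (simp only: Bochner_Integration.integral_sum[symmetric] Bochner_Integration.integrable_sum int)
  \<comment> \<open>Every fixed outcome of the coins gives a deterministic protocol, so the bound
    holds pointwise in \<open>R\<close>; it contradicts the \<open>V / 3\<close> of the first
    line.\<close>
  also have "\<dots> \<le> 2 ^ card strands * V / 5"
  proof (rule C.integral_le_const)
    show "integrable coin_space (\<lambda>R. \<Sum>a\<in>Pow strands. \<Sum>\<phi> | \<phi> permutes slots. \<Sum>T\<in>Pow steps. of_bool (ans R a \<phi> T) * gap T)"
      by (intro Bochner_Integration.integrable_sum int)
    show "AE R in coin_space. (\<Sum>a\<in>Pow strands. \<Sum>\<phi> | \<phi> permutes slots. \<Sum>T\<in>Pow steps. of_bool (ans R a \<phi> T) * gap T) \<le> 2 ^ card strands * V / 5"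
      unfolding ans_def V_def
      by (intro AE_I2 total_advantage_le[OF h M(1) _ M3 small few]) (auto simp: M_def A'_def)
  qed
  finally show False using V_def by (simp add: V_def field_simps)
qed

end

text \<open>There are about \<open>533 * ln n\<close> windows per component. Since
  \<open>1/200 < 1/128\<close>, the exponent \<open>w / 200 - w / 128\<close> outweighs the
  \<open>ln n\<close> of the union bound, even with \<open>2 ^ h\<close> enlarged to
  \<open>exp h\<close>. Moreover \<open>h \<ge> 2.6 * ln n\<close>, which makes
  \<open>t * 2 powr (- 3 * h / 4)\<close> small. The bound 10000 absorbs rounding.\<close>

lemma large_parameters:
  fixes n k t :: nat
  assumes n: "n = 4 * t * k" and t: "t > 0" and ln: "ln (real n) \<ge> 10000" and k: "real k \<ge> 1600 * ln (real n)"
  defines "w \<equiv> (k - 1) div 3" and "h \<equiv> ((k - 1) div 3) div 200"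
  shows "h > 0" and "real n / 300000 + 1 \<le> real h * real t / 64"
    and "real t * 2 powr (- 3 * real h / 4) \<le> 1/800"
    and "2 * real t * 2 ^ h * (127/128) ^ w \<le> 1/10"
proof -
  define l where "l = ln (real n)"
  have l: "l \<ge> 10000" "real k \<ge> 1600 * l" using ln k by (auto simp: l_def)
  have k0: "k > 0" using l by (cases k) auto
  have n0: "n > 0" using n t k0 by simp
  have el: "exp l = real n" using n0 by (simp add: l_def)
  have "real w * 3 \<ge> real k - 3" unfolding w_def by linarith
  then have w: "real w \<ge> 532 * l" "real w \<ge> real k / 3 - 1" using l by auto
  have hw: "real h \<ge> real w / 200 - 1" "real h \<le> real w / 200" unfolding h_def w_def by linarith+
  have h: "real h \<ge> 26/10 * l" using hw w l by linarith
  show "h > 0" using h l by (cases h) auto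
  have hk: "real h \<ge> real k / 1000" using hw w l by linarith
  have "2 * t * 1 \<le> 2 * t * (2 * k)" using k0 by (intro mult_left_mono) auto
  then have "2 * t \<le> n" unfolding n by simp
  then have tn: "2 * real t \<le> real n" by linarith
  have n16: "real n \<ge> 16000000"
  proof -
    have "k \<le> n" using n t by simp
    then have "real k \<le> real n" by (rule of_nat_mono)
    then show ?thesis using l by linarith
  qed
  \<comment> \<open>Here \<open>256000 = 4 * 64 * 1000\<close> comes from
    \<open>h \<ge> k / 1000\<close>; the slack up to 300000 absorbs the \<open>+ 1\<close> for
    rounding \<open>L\<close> up.\<close>
  have "real n / 300000 + 1 \<le> real n / 256000" using n16 by (simp add: field_simps)
  also have "\<dots> = (real k / 1000) * real t / 64" by (simp add: n)
  also have "\<dots> \<le> real h * real t / 64" using hk by (intro divide_right_mono mult_right_mono) auto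
  finally show "real n / 300000 + 1 \<le> real h * real t / 64" .
  have ex: "exp (- x) \<le> 1 / (1 + x)" if "x \<ge> 0" for x :: real
    using that exp_ge_add_one_self[of x] by (simp add: exp_minus field_simps) 
  have "2 powr (- 3 * real h / 4) = exp (- (3 * real h / 4 * ln 2))" by (simp add: powr_def)
  also have "\<dots> \<le> exp (- (13/10 * l))"
  proof -
    have "3 * real h / 4 * (2/3) \<le> 3 * real h / 4 * ln 2" using ln2_ge_two_thirds by (intro mult_left_mono) auto
    then show ?thesis using h by simp
  qed
  finally have "real t * 2 powr (- 3 * real h / 4) \<le> exp l * exp (- (13/10 * l))"
    using tn by (intro mult_mono) (auto simp: el)
  also have "\<dots> = exp (- (3/10 * l))" by (simp add: exp_add[symmetric])
  also have "\<dots> \<le> 1 / (1 + 3/10 * l)" using l by (intro ex) auto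
  also have "\<dots> \<le> 1/800" using l by (simp add: field_simps)
  finally show "real t * 2 powr (- 3 * real h / 4) \<le> 1/800" .
  have "(2 :: real) ^ h \<le> exp 1 ^ h" using exp_ge_add_one_self[of 1] by (intro power_mono) auto
  also have "\<dots> = exp (real h)" by (simp add: exp_of_nat_mult[symmetric])
  also have "\<dots> \<le> exp (real w / 200)" using hw by simp
  finally have p2: "(2 :: real) ^ h \<le> exp (real w / 200)" .
  have "(127/128 :: real) ^ w \<le> exp (- (1/128)) ^ w" using exp_ge_add_one_self[of "- (1/128)"] by (intro power_mono) auto
  also have "\<dots> = exp (- (real w / 128))" by (simp add: exp_of_nat_mult[symmetric])
  finally have p3: "(127/128 :: real) ^ w \<le> exp (- (real w / 128))" .
  have "2 * real t * 2 ^ h * (127/128) ^ w \<le> exp l * exp (real w / 200) * exp (- (real w / 128))"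
    using tn p2 p3 by (intro mult_mono) (auto simp: el)
  also have "\<dots> = exp (l + real w / 200 - real w / 128)" by (simp add: exp_add[symmetric])
  also have "\<dots> \<le> exp (- (1/10 * l))" using w l by simp
  also have "\<dots> \<le> 1 / (1 + 1/10 * l)" using l by (intro ex) auto
  also have "\<dots> \<le> 1/10" using l by (simp add: field_simps)
  finally show "2 * real t * 2 ^ h * (127/128) ^ w \<le> 1/10" .
qed

theorem theorem3p1:
  "\<exists>c::real. c > 0 \<and> (\<exists>N::nat. \<forall>n::nat. n \<ge> N \<longrightarrow>
     (\<forall>k::nat. NGC_well_defined n k \<longrightarrow> real k \<ge> 1600 * ln (real n) \<longrightarrow>
        ereal (c * real n) \<le> ereal_of_enat (robust_cc (NGC n k) (1/3))))"
proof (intro exI[of _ "1/300000 :: real"] conjI exI[of _ "nat \<lceil>exp 10000 :: real\<rceil>"] allI impI)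
  fix n k :: nat
  assume N: "n \<ge> nat \<lceil>exp 10000 :: real\<rceil>" and wd: "NGC_well_defined n k" and kln: "real k \<ge> 1600 * ln (real n)"
  from wd have "4 * k dvd n" and n0: "n > 0" and k3: "k \<ge> 3" by (auto simp: NGC_well_defined_def)
  then obtain t where n: "n = 4 * t * k" by (auto simp: mult_ac)
  with n0 have t: "t > 0" by (cases t) auto
  interpret layers t k by unfold_locales (use t k3 in auto)
  have "exp 10000 \<le> real n" using N by linarith
  then have "ln (real n) \<ge> 10000" using n0 by (subst ln_ge_iff) auto
  note params = large_parameters[OF n \<open>t > 0\<close> this kln, folded nwin_def]
  define L where "L = nat \<lceil>real n / 300000\<rceil>"
  have L0: "L > 0" using n0 by (simp add: L_def)
  have "real L \<le> real n / 300000 + 1" unfolding L_def by linarith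
  then have L: "real L \<le> real (nwin div 200) * real t / 64" using params(2) by linarith
  have "enat L \<le> robust_cc (NGC n k) (1/3)"
    unfolding robust_cc_def
  proof (rule Inf_greatest)
    fix v assume "v \<in> {cost (NGC n k) A | A B. protocol A B \<and> has_error (NGC n k) (1/3) A B}"
    then obtain A B where v: "v = cost (NGC n k) A" and AB: "protocol A B" "has_error (NGC n k) (1/3) A B" by auto
    show "enat L \<le> v"
    proof (rule ccontr)
      assume "\<not> enat L \<le> v"
      then have less: "cost (NGC n k) A < enat L" by (simp add: v)
      \<comment> \<open>Cost below \<open>L\<close> means at most \<open>L - 1\<close> bits, so the
        \<open>L + 1\<close> in \<open>no_cheap_protocol\<close> becomes \<open>L\<close>.\<close>
      have len: "length (A F R) \<le> L - 1" if "(E, ans) \<in> NGC n k" "F \<subseteq> E" for E ans F R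
      proof -
        have "enat (length (A F R)) \<le> (SUP R. enat (length (A F R)))" by (rule SUP_upper) simp
        also have "\<dots> \<le> cost (NGC n k) A"
          unfolding cost_def using that by (intro SUP_upper) auto
        finally have "enat (length (A F R)) < enat L" using less by (rule le_less_trans)
        then show ?thesis by simp
      qed
      show False
        by (rule no_cheap_protocol[OF AB(1) AB(2)[unfolded n] len[unfolded n] params(1) _ params(3) params(4)])
           (use L L0 in auto)
    qed
  qed
  then have "ereal_of_enat (enat L) \<le> ereal_of_enat (robust_cc (NGC n k) (1/3))" by (simp only: ereal_of_enat_le_iff)
  moreover have "ereal (1/300000 * real n) \<le> ereal_of_enat (enat L)" unfolding L_def by simp
  ultimately show "ereal (1/300000 * real n) \<le> ereal_of_enat (robust_cc (NGC n k) (1/3))" by (rule order_trans[rotated])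
qed simp

end
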